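(* Let $\mathcal{S}\subset\mathbb{C}^{n\times n}$ be a complex-linear or real-linear subspace, let $A\in\mathbb{C}^{n\times n}$ have all eigenvalues of negative real part, and fix $\varepsilon$ with $0<\varepsilon<\varepsilon_\star(A)$. For $\delta>0$ let $$E(\delta)=\arg\min_{E\in\mathbb{C}^{n\times n},\ \|E\|_F=1}\widetilde F_{\varepsilon,\delta}(E),\qquad \widetilde F_{\varepsilon,\delta}(E)=-\mathrm{Re}\,\lambda\Bigl(A+\varepsilon E+\delta\,\frac{\Pi^{\mathcal{S}}E}{\|\Pi^{\mathcal{S}}E\|_F}\Bigr),$$ let $\phi_\varepsilon(\delta)=\widetilde F_{\varepsilon,\delta}(E(\delta))$, and let $\delta_\varepsilon$ be the smallest positive zero of $\phi_\varepsilon$. Assume that for $\delta$ close to $\delta_\varepsilon$: (i) the rightmost eigenvalue $\lambda(\delta)=\lambda\bigl(A+\varepsilon E(\delta)+\delta\,\eta(\delta)\,\Pi^{\mathcal{S}}E(\delta)\bigr)$, with $\eta(\delta)=1/\|\Pi^{\mathcal{S}}E(\delta)\|_F$, is a simple eigenvalue; (ii) the map $\delta\mapsto E(\delta)$ is continuously differentiable. Let $x(\delta),y(\delta)$ be left and right eigenvectors to $\lambda(\delta)$ of unit norm with $x(\delta)^*y(\delta)>0$, and let $\kappa(\delta)=1/(x(\delta)^*y(\delta))>0$. Then $\phi_\varepsilon(\delta)=-\mathrm{Re}\,\lambda(\delta)$ is continuously differentiable in a neighborhood of $\delta_\varepsilon$, and its derivative there is $$\phi_\varepsilon'(\delta)=-\kappa(\delta)\,\bigl\|\Pi^{\mathcal{S}}\bigl(x(\delta)y(\delta)^*\bigr)\bigr\|_F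 .$$
   Context: For a square matrix $M$, $\lambda(M)$ denotes an eigenvalue of $M$ of maximal real part ("rightmost eigenvalue"; in case of several such eigenvalues, e.g. the one with maximal imaginary part). A left eigenvector $x$ satisfies $x^*M=\lambda x^*$, a right eigenvector $y$ satisfies $My=\lambda y$. $\langle X,Y\rangle=\mathrm{trace}(X^*Y)$ is the inner product on $\mathbb{C}^{n\times n}$ inducing the Frobenius norm $\|\cdot\|_F$. $\Pi^{\mathcal{S}}:\mathbb{C}^{n\times n}\to\mathcal{S}$ is the orthogonal projection onto $\mathcal{S}$ with respect to the real inner product: $\Pi^{\mathcal{S}}Z\in\mathcal{S}$ and $\mathrm{Re}\langle\Pi^{\mathcal{S}}Z,W\rangle=\mathrm{Re}\langle Z,W\rangle$ for all $W\in\mathcal{S}$. $\widetilde F_{\varepsilon,\delta}(E)$ is considered for matrices $E$ with $\Pi^{\mathcal{S}}E\ne0$. The stability radius $\varepsilon_\star(A)$ is the largest $\varepsilon>0$ such that for every $\Theta\in\mathbb{C}^{n\times n}$ with $\|\Theta\|_F\le\varepsilon$, the matrix $A+\Theta$ has no eigenvalue of positive real part. *)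

theory Defs
  imports "HOL-Analysis.Analysis" "HOL-Computational_Algebra.Polynomial"
begin

definition cnj_vec :: "complex ^ 'n \<Rightarrow> complex ^ 'n" where
  "cnj_vec x = (\<chi> i. cnj (x $ i))"

text \<open>\<open>cdot x y\<close> is $x^* y$, conjugate-linear in the first argument; \<open>outer x y\<close> is $x y^*$.\<close>

definition cdot :: "complex ^ 'n \<Rightarrow> complex ^ 'n \<Rightarrow> complex" where
  "cdot x y = (\<Sum>i\<in>UNIV. cnj (x $ i) * y $ i)"

definition outer :: "complex ^ 'n \<Rightarrow> complex ^ 'n \<Rightarrow> complex ^ 'n ^ 'n" where
  "outer x y = (\<chi> i j. x $ i * cnj (y $ j))"

definition ctranspose :: "complex ^ 'n ^ 'm \<Rightarrow> complex ^ 'm ^ 'n" where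
  "ctranspose X = map_matrix cnj (transpose X)"

definition frob_inner :: "complex ^ 'n ^ 'n \<Rightarrow> complex ^ 'n ^ 'n \<Rightarrow> complex" where
  "frob_inner X Y = trace (ctranspose X ** Y)"

text \<open>The library inner product on \<^typ>\<open>complex ^ 'n ^ 'n\<close> is the real part of
  \<^const>\<open>frob_inner\<close>, and the library norm is the Frobenius norm.\<close>

lemma Re_frob_inner: "Re (frob_inner X Y) = inner X Y"
proof -
  have "frob_inner X Y = (\<Sum>j\<in>UNIV. \<Sum>i\<in>UNIV. cnj (X $ i $ j) * Y $ i $ j)"
    by (simp add: frob_inner_def trace_def ctranspose_def matrix_matrix_mult_def
        map_matrix_def transpose_def)
  also have "\<dots> = (\<Sum>i\<in>UNIV. \<Sum>j\<in>UNIV. cnj (X $ i $ j) * Y $ i $ j)"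
    by (rule sum.swap)
  finally show ?thesis
    by (simp add: inner_vec_def inner_complex_def)
qed

lemma norm_eq_frobenius: "norm X = sqrt (Re (frob_inner X X))"
  by (simp add: Re_frob_inner norm_eq_sqrt_inner)

definition right_eigenvector :: "complex ^ 'n ^ 'n \<Rightarrow> complex \<Rightarrow> complex ^ 'n \<Rightarrow> bool" where
  "right_eigenvector M l y \<longleftrightarrow> y \<noteq> 0 \<and> M *v y = l *s y"

definition left_eigenvector :: "complex ^ 'n ^ 'n \<Rightarrow> complex \<Rightarrow> complex ^ 'n \<Rightarrow> bool" where
  "left_eigenvector M l x \<longleftrightarrow> x \<noteq> 0 \<and> cnj_vec x v* M = l *s cnj_vec x"

definition eigenvalue :: "complex ^ 'n ^ 'n \<Rightarrow> complex \<Rightarrow> bool" where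
  "eigenvalue M l \<longleftrightarrow> (\<exists>y. right_eigenvector M l y)"

definition char_poly :: "complex ^ 'n ^ 'n \<Rightarrow> complex poly" where
  "char_poly M = det (mat [:0, 1:] - map_matrix (\<lambda>a. [:a:]) M)"

text \<open>Simple means of algebraic multiplicity one.\<close>

definition simple_eigenvalue :: "complex ^ 'n ^ 'n \<Rightarrow> complex \<Rightarrow> bool" where
  "simple_eigenvalue M l \<longleftrightarrow> eigenvalue M l \<and> order l (char_poly M) = 1"

text \<open>The eigenvalue of maximal real part; among several of these, the one of maximal
  imaginary part.\<close>

definition rightmost_eigenvalue :: "complex ^ 'n ^ 'n \<Rightarrow> complex" where
  "rightmost_eigenvalue M =
    (THE l. eigenvalue M l \<and>
      (\<forall>m. eigenvalue M m \<longrightarrow> Re m < Re l \<or> Re m = Re l \<and> Im m \<le> Im l))"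

definition stability_radius :: "complex ^ 'n ^ 'n \<Rightarrow> real" where
  "stability_radius A =
    (GREATEST eps. eps > 0 \<and>
      (\<forall>\<Theta>. norm \<Theta> \<le> eps \<longrightarrow> \<not> (\<exists>l. eigenvalue (A + \<Theta>) l \<and> Re l > 0)))"

text \<open>For a real subspace \<open>S\<close> this is the projection that is orthogonal with respect to the
  real inner product $\mathrm{Re}\langle X, Y\rangle$. A complex subspace is in particular a real
  one.\<close>

definition orth_proj :: "(complex ^ 'n ^ 'n) set \<Rightarrow> complex ^ 'n ^ 'n \<Rightarrow> complex ^ 'n ^ 'n" where
  "orth_proj S Z =
    (THE P. P \<in> S \<and> (\<forall>W\<in>S. Re (frob_inner P W) = Re (frob_inner Z W)))"

text \<open>Meaningful only if \<open>orth_proj S E \<noteq> 0\<close>.\<close>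

definition F_tilde ::
  "(complex ^ 'n ^ 'n) set \<Rightarrow> complex ^ 'n ^ 'n \<Rightarrow> real \<Rightarrow> real \<Rightarrow> complex ^ 'n ^ 'n \<Rightarrow> real" where
  "F_tilde S A eps \<delta> E =
    - Re (rightmost_eigenvalue
        (A + eps *\<^sub>R E + \<delta> *\<^sub>R ((1 / norm (orth_proj S E)) *\<^sub>R orth_proj S E)))"

end

theory Submission
  imports Defs "HOL-Complex_Analysis.Great_Picard"
begin

text \<open>At a minimizer \<open>E\<close> of \<open>F_tilde\<close>, the matrix \<open>eps *\<^sub>R E + \<delta> *\<^sub>R sgn (orth_proj S E)\<close> lies on the
  boundary of the convex body of all \<open>eps *\<^sub>R X + \<delta> *\<^sub>R N\<close> with \<open>X\<close> in the unit ball and \<open>N\<close> in the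
  unit ball of \<open>S\<close>, and \<open>E\<close> itself is the outer normal there. No eigenvalue may move to the right
  along this boundary. Perturbations that shift one eigenvalue exactly, because they fix its left
  eigenvector \<open>z\<close>, show \<open>E = outer z w\<close>; so there is only one rightmost eigenvalue, and it is
  geometrically simple. First-order perturbation then gives \<open>outer x y = E\<close> up to the sign, and
  the curvature of the boundary fixes the sign. As \<open>E\<close> is orthogonal to its own derivative and to
  that of the unit vector \<open>sgn (orth_proj S E)\<close>, only the explicit dependence on \<open>\<delta>\<close> contributes
  to the derivative of the rightmost eigenvalue.\<close>

subsection \<open>The inner products\<close>

lemma cdot_add_right: "cdot a (b + c) = cdot a b + cdot a c"
  and cdot_diff_right: "cdot a (b - c) = cdot a b - cdot a c"
  and cdot_smult_left: "cdot (z *s a) b = cnj z * cdot a b"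
  and cdot_smult_right: "cdot a (z *s b) = z * cdot a b"
  and cdot_scaleR_left: "cdot (r *\<^sub>R a) b = r *\<^sub>R cdot a b"
  and cdot_scaleR_right: "cdot a (r *\<^sub>R b) = r *\<^sub>R cdot a b"
  by (simp_all add: cdot_def algebra_simps sum.distrib sum_subtractf sum_distrib_left
      scaleR_sum_right)

lemma cnj_cdot: "cnj (cdot a b) = cdot b a"
  by (simp add: cdot_def mult.commute)

lemma Re_cdot: "Re (cdot a b) = inner a b"
  by (simp add: cdot_def inner_vec_def inner_complex_def)

lemma cdot_self: "cdot a a = of_real ((norm a)\<^sup>2)"
proof (rule complex_eqI)
  have "cnj (cdot a a) = cdot a a" by (rule cnj_cdot)
  then show "Im (cdot a a) = Im (of_real ((norm a)\<^sup>2))"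
    by (simp add: complex_eq_iff)
qed (simp add: Re_cdot power2_norm_eq_inner)

lemma tendsto_cdot [tendsto_intros]:
  assumes "(f \<longlongrightarrow> a) F" "(g \<longlongrightarrow> b) F"
  shows "((\<lambda>k. cdot (f k) (g k)) \<longlongrightarrow> cdot a b) F"
  unfolding cdot_def by (intro tendsto_intros assms)

lemma tendsto_matrix_vector_mult [tendsto_intros]:
  fixes f :: "'b \<Rightarrow> complex ^ 'n ^ 'm"
  assumes "(f \<longlongrightarrow> a) F" "(g \<longlongrightarrow> b) F"
  shows "((\<lambda>k. f k *v g k) \<longlongrightarrow> a *v b) F"
  unfolding matrix_vector_mult_def by (intro tendsto_intros assms)

lemma scaleR_matrix_vector_mult: "(r *\<^sub>R X) *v v = r *\<^sub>R (X *v v)"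
  for X :: "complex ^ 'n ^ 'm"
  by (simp add: vec_eq_iff matrix_vector_mult_def scaleR_sum_right)

lemma mat_vector_mult: "mat z *v v = z *s v"
  for z :: complex
  by (simp add: vec_eq_iff matrix_vector_mult_def mat_def if_distrib if_distribR cong: if_cong)

lemma outer_vector_mult: "outer a b *v c = cdot b c *s a"
  by (simp add: vec_eq_iff matrix_vector_mult_def outer_def cdot_def sum_distrib_left
      algebra_simps)

text \<open>This makes \<open>outer x y\<close>, up to a positive factor, the gradient of the real
  part of an eigenvalue with left and right eigenvectors \<open>x\<close>, \<open>y\<close> when
  \<open>cdot x y\<close> is positive: first-order changes become inner products with it.\<close>

lemma inner_outer: "inner (outer a b) X = Re (cdot a (X *v b))"
  by (simp add: inner_vec_def inner_complex_def outer_def cdot_def matrix_vector_mult_def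
      sum_distrib_left algebra_simps sum.distrib sum_subtractf)

lemma norm_outer: "norm (outer a b) = norm a * norm b"
proof -
  have "(norm (outer a b))\<^sup>2 = Re (cdot a (outer a b *v b))"
    by (simp add: power2_norm_eq_inner inner_outer)
  also have "\<dots> = (norm a * norm b)\<^sup>2"
    by (simp add: outer_vector_mult cdot_smult_right cdot_self power_mult_distrib)
  finally show ?thesis by (rule power2_eq_imp_eq) simp_all
qed

lemma norm_smult: "norm (z *s v) = norm z * norm v"
  for v :: "complex ^ 'n"
  by (simp add: norm_vec_def L2_set_right_distrib norm_mult)

lemma scaleR_vec_smult: "r *\<^sub>R v = of_real r *s v"
  for v :: "complex ^ 'n"
  by (simp add: vec_eq_iff) (simp add: scaleR_conv_of_real)

lemma trace_outer: "trace (outer a b) = cdot b a"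
  by (simp add: trace_def outer_def cdot_def mult.commute)

subsection \<open>Eigenvalues\<close>

text \<open>Testing against axis vectors recovers each entry of the row vector equation. The form
  with \<open>cdot\<close> passes easily to limits and multiples.\<close>

lemma left_eigenvector_iff:
  "left_eigenvector M l x \<longleftrightarrow> x \<noteq> 0 \<and> (\<forall>z. cdot x (M *v z) = l * cdot x z)"
proof -
  have *: "cdot x (M *v z) = (\<Sum>j\<in>UNIV. (cnj_vec x v* M) $ j * z $ j)" for z
    unfolding cdot_def matrix_vector_mult_def vector_matrix_mult_def cnj_vec_def
    by (simp add: sum_distrib_left sum_distrib_right algebra_simps) (rule sum.swap)
  have **: "l * cdot x z = (\<Sum>j\<in>UNIV. (l *s cnj_vec x) $ j * z $ j)" for z
    by (simp add: cdot_def cnj_vec_def sum_distrib_left algebra_simps)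
  have "(cnj_vec x v* M) $ j = (l *s cnj_vec x) $ j"
    if "\<forall>z. cdot x (M *v z) = l * cdot x z" for j
    using that[rule_format, of "axis j 1"] unfolding * **
    by (simp add: axis_def if_distrib cong: if_cong)
  then have "cnj_vec x v* M = l *s cnj_vec x \<longleftrightarrow> (\<forall>z. cdot x (M *v z) = l * cdot x z)"
    unfolding vec_eq_iff[of "cnj_vec x v* M"] by (auto simp: * **)
  then show ?thesis
    unfolding left_eigenvector_def by simp
qed

lemma eigenvalue_iff_det: "eigenvalue M l \<longleftrightarrow> det (mat l - M) = 0"
proof -
  have "(mat l - M) *v y = 0 \<longleftrightarrow> M *v y = l *s y" for y
    by (auto simp: matrix_vector_mult_diff_rdistrib mat_vector_mult)
  moreover have "det (mat l - M) = 0 \<longleftrightarrow> \<not> (\<forall>y. (mat l - M) *v y = 0 \<longrightarrow> y = 0)"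
    by (metis invertible_det_nz invertible_left_inverse matrix_left_invertible_ker)
  ultimately show ?thesis
    by (auto simp: eigenvalue_def right_eigenvector_def)
qed

text \<open>Transposing preserves the determinant, and conjugating a right eigenvector of the
  transpose gives a left eigenvector of \<open>M\<close>.\<close>

lemma eigenvalue_iff_left_eigenvector: "eigenvalue M l \<longleftrightarrow> (\<exists>x. left_eigenvector M l x)"
proof -
  have t: "mat l - transpose M = transpose (mat l - M)"
    by (auto simp: vec_eq_iff transpose_def mat_def)
  have "eigenvalue M l \<longleftrightarrow> eigenvalue (transpose M) l"
    by (simp add: eigenvalue_iff_det t det_transpose)
  also have "\<dots> \<longleftrightarrow> (\<exists>y. y \<noteq> 0 \<and> y v* M = l *s y)"
    by (simp add: eigenvalue_def right_eigenvector_def)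
  also have "\<dots> \<longleftrightarrow> (\<exists>x. left_eigenvector M l x)"
  proof -
    have "cnj_vec (cnj_vec y) = y" "cnj_vec y = 0 \<longleftrightarrow> y = 0" for y :: "complex ^ 'a"
      by (simp_all add: cnj_vec_def vec_eq_iff)
    then have "y \<noteq> 0 \<and> y v* M = l *s y \<longleftrightarrow> left_eigenvector M l (cnj_vec y)" for y
      unfolding left_eigenvector_def by simp
    with \<open>\<And>y. cnj_vec (cnj_vec y) = y\<close> show ?thesis by metis
  qed
  finally show ?thesis .
qed

section \<open>Closedness and compactness of the spectrum\<close>

lemma tendsto_det [tendsto_intros]:
  fixes f :: "'b \<Rightarrow> complex ^ 'n ^ 'n"
  assumes "(f \<longlongrightarrow> X) F"
  shows "((\<lambda>k. det (f k)) \<longlongrightarrow> det X) F"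
  unfolding det_def by (intro tendsto_intros assms)

lemma tendsto_mat [tendsto_intros]:
  fixes f :: "'b \<Rightarrow> complex"
  assumes "(f \<longlongrightarrow> z) F"
  shows "((\<lambda>k. mat (f k) :: complex ^ 'n ^ 'n) \<longlongrightarrow> mat z) F"
proof -
  have "((\<lambda>k. if i = j then f k else 0) \<longlongrightarrow> (if i = j then z else 0)) F" for i j :: 'n
    using assms by simp
  then show ?thesis by (auto intro!: vec_tendstoI simp: mat_def)
qed

lemma eigenvalue_limit:
  fixes f :: "'b \<Rightarrow> complex ^ 'n ^ 'n"
  assumes "(f \<longlongrightarrow> M) F" "(m \<longlongrightarrow> l) F" "F \<noteq> bot" "\<forall>\<^sub>F k in F. eigenvalue (f k) (m k)"
  shows "eigenvalue M l"
proof -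
  have "((\<lambda>k. det (mat (m k) - f k)) \<longlongrightarrow> det (mat l - M)) F"
    by (intro tendsto_intros assms)
  moreover have "((\<lambda>k. det (mat (m k) - f k)) \<longlongrightarrow> 0) F"
    using assms(4) by (auto simp: eigenvalue_iff_det intro: tendsto_eventually)
  ultimately show ?thesis
    using assms(3) unfolding eigenvalue_iff_det by (rule tendsto_unique[rotated])
qed

text \<open>The constant comes from the boundedness of a bilinear map and is the same for all
  matrices, so eigenvalues along a convergent sequence of matrices stay bounded.\<close>

lemma eigenvalue_norm_bound:
  obtains C where "\<And>M l. eigenvalue (M :: complex ^ 'n ^ 'n) l \<Longrightarrow> norm l \<le> C * norm M"
proof -
  have "bilinear (\<lambda>(M :: complex ^ 'n ^ 'n) v. M *v v)"
    unfolding bilinear_def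
    by (intro conjI allI linearI)
      (simp_all add: matrix_vector_mult_add_rdistrib matrix_vector_right_distrib
        scaleR_matrix_vector_mult vec_eq_iff matrix_vector_mult_def scaleR_sum_right algebra_simps sum.distrib)
  then obtain C where C: "\<And>(M :: complex ^ 'n ^ 'n) v. norm (M *v v) \<le> C * norm M * norm v"
    using bilinear_bounded by blast
  have "norm l \<le> C * norm M" if ev: "eigenvalue M l" for M :: "complex ^ 'n ^ 'n" and l
  proof -
    obtain v where v: "v \<noteq> 0" "M *v v = l *s v"
      using ev by (auto simp: eigenvalue_def right_eigenvector_def)
    then show ?thesis using C[of M v] by (simp add: norm_smult)
  qed
  with that show ?thesis by blast
qed

lemma compact_spectrum: "compact {l. eigenvalue (M :: complex ^ 'n ^ 'n) l}"
proof -
  obtain C where "\<And>N l. eigenvalue (N :: complex ^ 'n ^ 'n) l \<Longrightarrow> norm l \<le> C * norm N"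
    using eigenvalue_norm_bound by blast
  then have "bounded {l. eigenvalue M l}" by (auto simp: bounded_iff)
  moreover have "closed {l. eigenvalue M l}"
    unfolding closed_sequential_limits
    by (auto intro!: eigenvalue_limit[where f = "\<lambda>_. M" and F = sequentially])
  ultimately show ?thesis by (simp add: compact_eq_bounded_closed)
qed

text \<open>The description in the definition singles out the lexicographic maximum of real and
  imaginary part. It exists because the spectrum is compact, and \<open>l\<close> shows that the
  spectrum is nonempty.\<close>

lemma rightmost_eigenvalue:
  fixes M :: "complex ^ 'n ^ 'n"
  assumes "eigenvalue M l"
  shows "eigenvalue M (rightmost_eigenvalue M)" "Re l \<le> Re (rightmost_eigenvalue M)"
proof -
  let ?Q = "\<lambda>l. eigenvalue M l \<and>
      (\<forall>m. eigenvalue M m \<longrightarrow> Re m < Re l \<or> Re m = Re l \<and> Im m \<le> Im l)"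
  obtain a where a: "eigenvalue M a" "\<And>m. eigenvalue M m \<Longrightarrow> Re m \<le> Re a"
    using continuous_attains_sup[OF compact_spectrum[of M], of Re] assms
      continuous_on_Re[OF continuous_on_id] by auto
  \<comment> \<open>The slice of maximal real part is again compact, so the imaginary part attains
    its maximum there.\<close>
  let ?T = "{l. eigenvalue M l} \<inter> {l. Re l = Re a}"
  have "compact ?T"
    by (intro compact_Int_closed compact_spectrum closed_Collect_eq continuous_intros)
  then obtain b where b: "b \<in> ?T" "\<And>m. m \<in> ?T \<Longrightarrow> Im m \<le> Im b"
    using continuous_attains_sup[of ?T Im] a(1) continuous_on_Im[OF continuous_on_id] by auto
  have "?Q b" using a b by force
  moreover have "c = b" if "?Q c" for c
    using that[THEN conjunct2, rule_format, of b] that[THEN conjunct1] \<open>?Q b\<close>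
    by (intro complex_eqI) force+
  ultimately have "?Q (rightmost_eigenvalue M)"
    unfolding rightmost_eigenvalue_def by (rule theI)
  then show "eigenvalue M (rightmost_eigenvalue M)" "Re l \<le> Re (rightmost_eigenvalue M)"
    using assms by force+
qed

subsection \<open>Perturbation of eigenvalues\<close>

lemma holomorphic_on_det_resolvent:
  fixes M :: "complex ^ 'n ^ 'n"
  shows "(\<lambda>z. det (mat z - M)) holomorphic_on U"
proof -
  have "(\<lambda>z. (mat z - M) $ i $ j) holomorphic_on U" for i j
    by (cases "i = j") (auto simp: mat_def intro!: holomorphic_intros)
  then show ?thesis
    unfolding det_def by (intro holomorphic_intros)
qed

lemma continuous_on_det_resolvent:
  "continuous_on UNIV (\<lambda>p. det (mat (fst p) - (snd p :: complex ^ 'n ^ 'n)))"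
  unfolding continuous_on_def by (auto intro!: tendsto_intros tendsto_fst tendsto_snd tendsto_ident_at simp del: split_paired_All)

text \<open>If the spectra along a subsequence avoided the ball, the functions
  \<open>det (mat z - X (r k))\<close> would have no zeros there, and by Hurwitz's theorem neither
  would their limit \<open>det (mat z - M)\<close>, which vanishes at \<open>l\<close>.\<close>

lemma eigenvalue_perturbation:
  fixes M :: "complex ^ 'n ^ 'n" and X :: "nat \<Rightarrow> complex ^ 'n ^ 'n"
  assumes X: "X \<longlonglongrightarrow> M" and l: "eigenvalue M l" and e: "e > 0"
  shows "\<forall>\<^sub>F k in sequentially. \<exists>m. eigenvalue (X k) m \<and> dist l m < e"
proof (rule ccontr)
  assume "\<not> ?thesis"
  then obtain r :: "nat \<Rightarrow> nat" where r: "strict_mono r"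
    and no: "\<And>k m. eigenvalue (X (r k)) m \<Longrightarrow> \<not> dist l m < e"
    using not_eventually_sequentiallyD by blast
  have Xr: "(\<lambda>k. X (r k)) \<longlonglongrightarrow> M"
    using LIMSEQ_subseq_LIMSEQ[OF X r] by (simp add: o_def)
  have "det (mat l - M) \<noteq> 0"
  proof (rule Hurwitz_no_zeros[of "ball l e" "\<lambda>k z. det (mat z - X (r k))" "\<lambda>z. det (mat z - M)"])
    fix K assume K: "compact K" "K \<subseteq> ball l e"
    \<comment> \<open>Uniform convergence on \<open>K\<close> comes from uniform continuity of the
      determinant on this compact product.\<close>
    have "compact (K \<times> cball M 1)"
      using K by (intro compact_Times) auto
    then have "uniformly_continuous_on (K \<times> cball M 1) (\<lambda>p. det (mat (fst p) - snd p))"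
      by (intro compact_uniformly_continuous continuous_on_subset[OF continuous_on_det_resolvent]) auto
    moreover have "uniform_limit K (\<lambda>k z. (z, X (r k))) (\<lambda>z. (z, M)) sequentially"
      using Xr by (auto simp: uniform_limit_iff dist_Pair_Pair tendsto_iff elim!: eventually_mono)
    moreover have "\<forall>\<^sub>F k in sequentially. \<forall>z\<in>K. (z, X (r k)) \<in> K \<times> cball M 1"
      using tendstoD[OF Xr zero_less_one] by eventually_elim (auto simp: dist_commute)
    ultimately show "uniform_limit K (\<lambda>k z. det (mat z - X (r k))) (\<lambda>z. det (mat z - M)) sequentially"
      using uniform_limit_compose_uniformly_continuous_on[where A = K and g = "\<lambda>k z. (z, X (r k))"
          and g' = "\<lambda>z. (z, M)" and B = "K \<times> cball M 1" and f = "\<lambda>p. det (mat (fst p) - snd p)"] K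
      by (simp add: closed_Times compact_imp_closed)
  next
    \<comment> \<open>A constant value would be 0, and by analytic continuation every complex number
      would be an eigenvalue, contrary to compactness of the spectrum.\<close>
    show "\<not> (\<lambda>z. det (mat z - M)) constant_on ball l e"
    proof
      assume "(\<lambda>z. det (mat z - M)) constant_on ball l e"
      moreover have "l \<in> ball l e" using e by simp
      ultimately have zero: "det (mat z - M) = 0" if "z \<in> ball l e" for z
        using l that unfolding constant_on_def eigenvalue_iff_det by metis
      have "det (mat z - M) = 0" for z
        by (rule analytic_continuation[OF holomorphic_on_det_resolvent open_UNIV connected_UNIV,
              of "ball l e" l]) (use e zero in \<open>auto simp: islimpt_ball\<close>)
      then have "{z. eigenvalue M z} = UNIV" by (auto simp: eigenvalue_iff_det)
      then show False using compact_spectrum[of M] not_bounded_UNIV compact_imp_bounded by metis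
    qed
  next
    show "det (mat z - X (r k)) \<noteq> 0" if "z \<in> ball l e" for k z
      using no[of k z] that by (auto simp: eigenvalue_iff_det)
  qed (use e in \<open>auto intro: holomorphic_on_det_resolvent\<close>)
  with l show False by (simp add: eigenvalue_iff_det)
qed

text \<open>Take for \<open>m k\<close> an eigenvalue of \<open>X k\<close> nearest to
  \<open>l\<close>; it exists because the spectrum is closed, and
  \<open>eigenvalue_perturbation\<close> makes the distances tend to 0.\<close>

lemma eigenvalue_approximation:
  fixes M :: "complex ^ 'n ^ 'n" and X :: "nat \<Rightarrow> complex ^ 'n ^ 'n"
  assumes X: "X \<longlonglongrightarrow> M" and l: "eigenvalue M l"
  obtains m where "m \<longlonglongrightarrow> l" "\<forall>\<^sub>F k in sequentially. eigenvalue (X k) (m k)"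
proof -
  have "\<exists>m. eigenvalue (X k) n \<longrightarrow> eigenvalue (X k) m \<and> (\<forall>n. eigenvalue (X k) n \<longrightarrow> dist l m \<le> dist l n)" for k n
    using distance_attains_inf[OF compact_imp_closed[OF compact_spectrum[of "X k"]], of l] by auto
  then have "\<exists>m. \<forall>n. eigenvalue (X k) n \<longrightarrow> eigenvalue (X k) m \<and> dist l m \<le> dist l n" for k
    by meson
  then obtain m where m: "\<And>k n. eigenvalue (X k) n \<Longrightarrow> eigenvalue (X k) (m k) \<and> dist l (m k) \<le> dist l n"
    by metis
  have "\<forall>\<^sub>F k in sequentially. dist (m k) l < e" if "e > 0" for e
    using eigenvalue_perturbation[OF X l that]
    by eventually_elim (use m in \<open>auto simp: dist_commute intro: le_less_trans\<close>)
  then have "m \<longlonglongrightarrow> l" by (rule tendstoI)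
  moreover have "\<forall>\<^sub>F k in sequentially. eigenvalue (X k) (m k)"
    using eigenvalue_perturbation[OF X l zero_less_one] by eventually_elim (use m in blast)
  ultimately show ?thesis by (rule that)
qed

section \<open>First-order perturbation of eigenvalues\<close>

lemma left_eigenvector_smult:
  assumes "left_eigenvector M l x" "c \<noteq> 0"
  shows "left_eigenvector M l (c *s x)"
  using assms by (simp add: left_eigenvector_iff cdot_smult_left)

text \<open>The difference quotients are read off from left eigenvectors \<open>v k\<close> of \<open>X k\<close>, because
  \<open>(m k - l) * cdot (v k) y = cdot (v k) ((X k - M) *v y)\<close>.\<close>

lemma eigenvalue_quotient_limit:
  fixes M :: "complex ^ 'n ^ 'n" and X :: "nat \<Rightarrow> complex ^ 'n ^ 'n" and \<tau> :: "nat \<Rightarrow> real"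
  assumes X: "X \<longlonglongrightarrow> M" and m: "m \<longlonglongrightarrow> l" and ev: "\<And>k. eigenvalue (X k) (m k)"
    and left: "\<And>z. left_eigenvector M l z \<Longrightarrow> \<exists>c. z = c *s x"
    and y: "M *v y = l *s y" and xy: "cdot x y \<noteq> 0"
    and u: "(\<lambda>k. (1 / \<tau> k) *\<^sub>R ((X k - M) *v y)) \<longlonglongrightarrow> u"
  obtains r :: "nat \<Rightarrow> nat" where "strict_mono r"
    "(\<lambda>k. (m (r k) - l) / of_real (\<tau> (r k))) \<longlonglongrightarrow> cdot x u / cdot x y"
proof -
  have "\<exists>v. left_eigenvector (X k) (m k) v \<and> norm v = 1" for k
  proof -
    obtain v where v: "left_eigenvector (X k) (m k) v"
      using ev eigenvalue_iff_left_eigenvector by blast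
    have "v \<noteq> 0" using v by (simp add: left_eigenvector_def)
    have "left_eigenvector (X k) (m k) ((1 / norm v) *\<^sub>R v)"
      using v by (simp add: left_eigenvector_iff cdot_scaleR_left)
    with \<open>v \<noteq> 0\<close> show ?thesis by (intro exI[of _ "(1 / norm v) *\<^sub>R v"]) simp
  qed
  then obtain v where v: "\<And>k. left_eigenvector (X k) (m k) (v k)" "\<And>k. norm (v k) = 1"
    by metis
  \<comment> \<open>The unit vectors \<open>v k\<close> may fail to converge; compactness of the
    sphere gives a convergent subsequence.\<close>
  have "compact (sphere (0 :: complex ^ 'n) 1)" by simp
  then obtain w r where w: "norm w = 1" and r: "strict_mono (r :: nat \<Rightarrow> nat)" and lim: "(v \<circ> r) \<longlonglongrightarrow> w"
    using v(2) unfolding compact_def by (metis dist_0_norm mem_sphere)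
  have vr: "(\<lambda>k. v (r k)) \<longlonglongrightarrow> w" using lim by (simp add: o_def)
  have Xr: "(\<lambda>k. X (r k)) \<longlonglongrightarrow> M" and mr: "(\<lambda>k. m (r k)) \<longlonglongrightarrow> l"
    and ur: "(\<lambda>k. (1 / \<tau> (r k)) *\<^sub>R ((X (r k) - M) *v y)) \<longlonglongrightarrow> u"
    using LIMSEQ_subseq_LIMSEQ[OF X r] LIMSEQ_subseq_LIMSEQ[OF m r] LIMSEQ_subseq_LIMSEQ[OF u r]
    by (simp_all add: o_def)
  have eq: "cdot (v k) (X k *v z) = m k * cdot (v k) z" for k z
    using v(1)[of k] by (simp add: left_eigenvector_iff)
  have "cdot w (M *v z) = l * cdot w z" for z
  proof (rule LIMSEQ_unique)
    show "(\<lambda>k. cdot (v (r k)) (X (r k) *v z)) \<longlonglongrightarrow> cdot w (M *v z)"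
      by (intro tendsto_intros vr Xr)
    show "(\<lambda>k. cdot (v (r k)) (X (r k) *v z)) \<longlonglongrightarrow> l * cdot w z"
      unfolding eq by (intro tendsto_intros vr mr)
  qed
  moreover have "w \<noteq> 0" using w by auto
  \<comment> \<open>The limit is a nonzero multiple of \<open>x\<close>, and the factor cancels from
    the quotient.\<close>
  ultimately obtain c where c: "w = c *s x"
    using left by (auto simp: left_eigenvector_iff)
  with \<open>w \<noteq> 0\<close> have "c \<noteq> 0" by auto
  have wy: "cdot w y \<noteq> 0" using c \<open>c \<noteq> 0\<close> xy by (simp add: cdot_smult_left)
  have vy: "(\<lambda>k. cdot (v (r k)) y) \<longlonglongrightarrow> cdot w y" by (intro tendsto_intros vr)
  have "(\<lambda>k. cdot (v (r k)) ((1 / \<tau> (r k)) *\<^sub>R ((X (r k) - M) *v y)) / cdot (v (r k)) y)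
      \<longlonglongrightarrow> cdot w u / cdot w y"
    by (intro tendsto_intros vr ur wy)
  moreover have "cdot w u / cdot w y = cdot x u / cdot x y"
    using \<open>c \<noteq> 0\<close> by (simp add: c cdot_smult_left)
  moreover have "\<forall>\<^sub>F k in sequentially.
    cdot (v (r k)) ((1 / \<tau> (r k)) *\<^sub>R ((X (r k) - M) *v y)) / cdot (v (r k)) y
      = (m (r k) - l) / of_real (\<tau> (r k))"
    using tendsto_imp_eventually_ne[OF vy wy]
  proof eventually_elim
    case (elim k)
    have "cdot (v (r k)) ((X (r k) - M) *v y) = (m (r k) - l) * cdot (v (r k)) y"
      by (simp add: matrix_vector_mult_diff_rdistrib cdot_diff_right eq y cdot_smult_right
          algebra_simps)
    with elim show ?case
      unfolding cdot_scaleR_right by (simp add: scaleR_conv_of_real)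
  qed
  ultimately have "(\<lambda>k. (m (r k) - l) / of_real (\<tau> (r k))) \<longlonglongrightarrow> cdot x u / cdot x y"
    using tendsto_cong by fastforce
  with r show ?thesis by (rule that)
qed

text \<open>Eigenvalues of \<open>X k\<close> tending to \<open>l\<close> have difference quotients
  with nonpositive real part, and a subsequence of these converges to the quotient in
  question.\<close>

lemma eigenvalue_first_order_bound:
  fixes M :: "complex ^ 'n ^ 'n" and X :: "nat \<Rightarrow> complex ^ 'n ^ 'n" and \<tau> :: "nat \<Rightarrow> real"
  assumes X: "X \<longlonglongrightarrow> M" and \<tau>: "\<And>k. \<tau> k > 0"
    and max: "\<And>k m. eigenvalue (X k) m \<Longrightarrow> Re m \<le> Re l"
    and left: "\<And>z. left_eigenvector M l z \<Longrightarrow> \<exists>c. z = c *s x"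
    and y: "M *v y = l *s y" and xy: "cdot x y \<noteq> 0"
    and u: "(\<lambda>k. (1 / \<tau> k) *\<^sub>R ((X k - M) *v y)) \<longlonglongrightarrow> u"
  shows "Re (cdot x u / cdot x y) \<le> 0"
proof -
  have "y \<noteq> 0" using xy by (auto simp: cdot_def)
  with y have "eigenvalue M l" by (auto simp: eigenvalue_def right_eigenvector_def)
  with X obtain m where m: "m \<longlonglongrightarrow> l" "\<forall>\<^sub>F k in sequentially. eigenvalue (X k) (m k)"
    by (rule eigenvalue_approximation)
  \<comment> \<open>The \<open>m k\<close> are known to be eigenvalues only from some index on, so
    the first \<open>K\<close> terms are dropped.\<close>
  then obtain K where K: "\<And>k. eigenvalue (X (k + K)) (m (k + K))"
    unfolding eventually_sequentially by (metis le_add2)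
  obtain r :: "nat \<Rightarrow> nat" where
    "(\<lambda>k. (m (r k + K) - l) / of_real (\<tau> (r k + K))) \<longlonglongrightarrow> cdot x u / cdot x y"
    by (rule eigenvalue_quotient_limit[OF LIMSEQ_ignore_initial_segment[OF X]
          LIMSEQ_ignore_initial_segment[OF m(1)] K left y xy LIMSEQ_ignore_initial_segment[OF u]])
  then have "(\<lambda>k. Re ((m (r k + K) - l) / of_real (\<tau> (r k + K)))) \<longlonglongrightarrow> Re (cdot x u / cdot x y)"
    by (rule tendsto_Re)
  moreover have "Re ((m (r k + K) - l) / of_real (\<tau> (r k + K))) \<le> 0" for k
    using max[OF K[of "r k"]] \<tau>[of "r k + K"] by (simp add: divide_le_0_iff)
  ultimately show ?thesis by (intro LIMSEQ_le_const2) auto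
qed

subsection \<open>The coupled sphere\<close>

text \<open>The orthogonal decomposition along \<open>S\<close> supplies a matrix fitting the
  description in the definition. Two such matrices differ by an element of \<open>S\<close>
  orthogonal to itself, so there is only one.\<close>

lemma orth_proj:
  assumes "subspace S"
  shows orth_proj_in: "orth_proj S Z \<in> S"
    and inner_orth_proj: "\<And>W. W \<in> S \<Longrightarrow> inner (orth_proj S Z) W = inner Z W"
    and orth_proj_eqI:
      "\<And>P. P \<in> S \<Longrightarrow> (\<And>W. W \<in> S \<Longrightarrow> inner P W = inner Z W) \<Longrightarrow> orth_proj S Z = P"
proof -
  let ?Q = "\<lambda>P. P \<in> S \<and> (\<forall>W\<in>S. Re (frob_inner P W) = Re (frob_inner Z W))"
  have span: "span S = S" using assms by (simp add: span_eq_iff)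
  obtain p q where pq: "p \<in> span S" "\<And>w. w \<in> span S \<Longrightarrow> orthogonal q w" "Z = p + q"
    using orthogonal_subspace_decomp_exists[of S Z] by blast
  then have "?Q p" by (simp add: span Re_frob_inner inner_add_left orthogonal_def)
  have uniq: "P = p" if "?Q P" for P
  proof -
    have "P - p \<in> S" using that \<open>?Q p\<close> assms by (simp add: subspace_diff)
    then have "inner (P - p) (P - p) = 0"
      using that \<open>?Q p\<close> by (simp add: Re_frob_inner inner_diff_left[of P p "P - p"])
    then show ?thesis by simp
  qed
  have "?Q (orth_proj S Z)" and eq: "orth_proj S Z = p"
    unfolding orth_proj_def using theI[of ?Q, OF \<open>?Q p\<close> uniq] the_equality[of ?Q, OF \<open>?Q p\<close> uniq]
    by blast+
  then show "orth_proj S Z \<in> S" "\<And>W. W \<in> S \<Longrightarrow> inner (orth_proj S Z) W = inner Z W"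
    by (auto simp: Re_frob_inner)
  show "orth_proj S Z = P" if "P \<in> S" "\<And>W. W \<in> S \<Longrightarrow> inner P W = inner Z W" for P
    using uniq[of P] that eq by (simp add: Re_frob_inner)
qed

lemma linear_orth_proj:
  assumes S: "subspace S"
  shows "linear (orth_proj S)"
proof (rule linearI)
  show "orth_proj S (a + b) = orth_proj S a + orth_proj S b" for a b
    by (rule orth_proj_eqI[OF S])
      (simp_all add: S subspace_add orth_proj_in inner_add_left inner_orth_proj)
  show "orth_proj S (r *\<^sub>R a) = r *\<^sub>R orth_proj S a" for r a
    by (rule orth_proj_eqI[OF S])
      (simp_all add: S subspace_scale orth_proj_in inner_orth_proj)
qed

lemma orth_proj_of_mem: "subspace S \<Longrightarrow> X \<in> S \<Longrightarrow> orth_proj S X = X"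
  by (rule orth_proj_eqI) auto

lemma norm_orth_proj_le:
  assumes S: "subspace S"
  shows "norm (orth_proj S X) \<le> norm X"
proof -
  have "norm (orth_proj S X) * norm (orth_proj S X) = inner X (orth_proj S X)"
    using inner_orth_proj[OF S orth_proj_in[OF S], of X X] by (metis power2_norm_eq_inner power2_eq_square)
  also have "\<dots> \<le> norm X * norm (orth_proj S X)" by (rule norm_cauchy_schwarz)
  finally show ?thesis by (cases "orth_proj S X = 0") auto
qed

lemma sgn_orth_proj_in: "subspace S \<Longrightarrow> sgn (orth_proj S X) \<in> S"
  by (simp add: sgn_div_norm subspace_scale orth_proj_in)

lemma inner_sgn_orth_proj:
  assumes S: "subspace S"
  shows "inner X (sgn (orth_proj S X)) = norm (orth_proj S X)"
proof -
  have "inner X (sgn (orth_proj S X)) = inner (orth_proj S X) (sgn (orth_proj S X))"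
    using inner_orth_proj[OF S sgn_orth_proj_in[OF S]] by metis
  also have "\<dots> = inverse (norm (orth_proj S X)) * (norm (orth_proj S X))\<^sup>2"
    by (simp add: sgn_div_norm power2_norm_eq_inner)
  finally show ?thesis by (cases "orth_proj S X = 0") (simp_all add: power2_eq_square)
qed

text \<open>With \<open>inner_sgn_orth_proj\<close>, this identifies
  \<open>norm (orth_proj S X)\<close> as the support function of the unit ball of \<open>S\<close>,
  attained at \<open>sgn (orth_proj S X)\<close>.\<close>

lemma inner_orth_proj_le:
  assumes S: "subspace S" and N: "N \<in> S" "norm N \<le> 1"
  shows "inner X N \<le> norm (orth_proj S X)"
proof -
  have "inner X N = inner (orth_proj S X) N" using inner_orth_proj[OF S N(1)] by simp
  also have "\<dots> \<le> norm (orth_proj S X) * norm N" by (rule norm_cauchy_schwarz)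
  also have "\<dots> \<le> norm (orth_proj S X)" using N(2) by (simp add: mult_left_le)
  finally show ?thesis .
qed

text \<open>In the expanded square only \<open>inner \<Phi> N\<close> depends on the unit matrix
  \<open>N\<close>, and the normalized projection maximizes it.\<close>

lemma norm_diff_sgn_orth_proj_le:
  assumes S: "subspace S" and N: "N \<in> S" "norm N = 1" and \<delta>: "\<delta> \<ge> 0"
    and nz: "orth_proj S \<Phi> \<noteq> 0"
  shows "norm (\<Phi> - \<delta> *\<^sub>R sgn (orth_proj S \<Phi>)) \<le> norm (\<Phi> - \<delta> *\<^sub>R N)"
proof -
  have sq: "(norm (\<Phi> - \<delta> *\<^sub>R N'))\<^sup>2 = (norm \<Phi>)\<^sup>2 - 2 * \<delta> * inner \<Phi> N' + \<delta>\<^sup>2" if "norm N' = 1" for N'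
  proof -
    have "inner N' N' = 1" using that by (simp flip: power2_norm_eq_inner)
    then show ?thesis
      unfolding power2_norm_eq_inner by (simp add: inner_diff inner_commute power2_eq_square)
  qed
  have "\<delta> * inner \<Phi> N \<le> \<delta> * inner \<Phi> (sgn (orth_proj S \<Phi>))"
    using inner_orth_proj_le[OF S N(1)] N(2) \<delta> by (simp add: mult_left_mono inner_sgn_orth_proj S)
  then have "(norm (\<Phi> - \<delta> *\<^sub>R sgn (orth_proj S \<Phi>)))\<^sup>2 \<le> (norm (\<Phi> - \<delta> *\<^sub>R N))\<^sup>2"
    using nz N(2) by (simp add: sq norm_sgn)
  then show ?thesis by (rule power2_le_imp_le) simp
qed

text \<open>This inverts the map from \<open>E\<close> to
  \<open>eps *\<^sub>R E + \<delta> *\<^sub>R sgn (orth_proj S E)\<close>. The condition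
  \<open>big\<close> ensures that subtracting the second summand preserves the direction of the
  projection.\<close>

lemma coupled_sphere_member:
  assumes S: "subspace S" and eps: "eps > 0" and \<delta>: "\<delta> > 0"
    and big: "norm (orth_proj S \<Phi>) > \<delta>"
    and eq: "norm (\<Phi> - \<delta> *\<^sub>R sgn (orth_proj S \<Phi>)) = eps"
  obtains E where "norm E = 1" "orth_proj S E \<noteq> 0" "\<Phi> = eps *\<^sub>R E + \<delta> *\<^sub>R sgn (orth_proj S E)"
proof
  let ?P = "orth_proj S \<Phi>"
  define E where "E = (1 / eps) *\<^sub>R (\<Phi> - \<delta> *\<^sub>R sgn ?P)"
  interpret linear "orth_proj S" using S by (rule linear_orth_proj)
  have nz: "?P \<noteq> 0" using big \<delta> by auto
  have "orth_proj S E = (1 / eps) *\<^sub>R (?P - \<delta> *\<^sub>R sgn ?P)"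
    by (simp add: E_def scale diff orth_proj_of_mem S sgn_orth_proj_in)
  also have "?P - \<delta> *\<^sub>R sgn ?P = (norm ?P - \<delta>) *\<^sub>R sgn ?P"
    using nz by (simp add: sgn_div_norm algebra_simps)
  finally have P: "orth_proj S E = ((norm ?P - \<delta>) / eps) *\<^sub>R sgn ?P" by simp
  have pos: "(norm ?P - \<delta>) / eps > 0" using big eps by simp
  show "norm E = 1" using eq eps by (simp add: E_def)
  show "orth_proj S E \<noteq> 0" unfolding P using pos nz by (auto simp: sgn_zero_iff)
  have "sgn (orth_proj S E) = sgn ?P" unfolding P using pos nz by (simp add: sgn_scaleR sgn_div_norm[of "sgn ?P"] norm_sgn del: sgn_divide)
  then show "\<Phi> = eps *\<^sub>R E + \<delta> *\<^sub>R sgn (orth_proj S E)" using eps by (simp add: E_def)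
qed

text \<open>The matrices \<open>eps *\<^sub>R E + \<delta> *\<^sub>R sgn (orth_proj S E)\<close> with \<open>norm E = 1\<close> form part of the
  boundary of a convex body whose outer normal at the given point is \<open>E\<^sub>0\<close>. A segment in
  direction \<open>D\<close> that leads from the inside to the outside therefore meets this boundary.\<close>

lemma coupled_sphere_hit:
  fixes E\<^sub>0 \<Theta> D :: "complex ^ 'n ^ 'n"
  assumes S: "subspace S" and eps: "eps > 0" and \<delta>: "\<delta> > 0"
    and E0: "norm E\<^sub>0 = 1" "orth_proj S E\<^sub>0 \<noteq> 0"
    and inside: "inner E\<^sub>0 (\<Theta> + b *\<^sub>R D) < 0"
    and outside: "inner E\<^sub>0 (\<Theta> + a *\<^sub>R D) \<ge> 0" "\<Theta> + a *\<^sub>R D \<noteq> 0"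
    and ba: "b < a"
  defines "\<Phi>\<^sub>0 \<equiv> eps *\<^sub>R E\<^sub>0 + \<delta> *\<^sub>R sgn (orth_proj S E\<^sub>0)"
  shows "\<forall>\<^sub>F t in at_right 0. \<exists>s E. b * t < s \<and> s < a * t \<and> norm E = 1 \<and> orth_proj S E \<noteq> 0 \<and>
    eps *\<^sub>R E + \<delta> *\<^sub>R sgn (orth_proj S E) = \<Phi>\<^sub>0 + t *\<^sub>R \<Theta> + s *\<^sub>R D"
proof -
  let ?\<rho> = "norm (orth_proj S E\<^sub>0)" and ?N\<^sub>0 = "sgn (orth_proj S E\<^sub>0)"
  \<comment> \<open>Where the projection is nonzero, \<open>g \<Phi>\<close> is the distance from
    \<open>\<Phi>\<close> to the sphere of radius \<open>\<delta>\<close> in \<open>S\<close>. Near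
    \<open>\<Phi>\<^sub>0\<close> the surface is the level set of \<open>g\<close> at
    \<open>eps\<close>.\<close>
  define g where "g \<Phi> = norm (\<Phi> - \<delta> *\<^sub>R sgn (orth_proj S \<Phi>))" for \<Phi>
  interpret linear "orth_proj S" using S by (rule linear_orth_proj)
  have N0: "?N\<^sub>0 \<in> S" "norm ?N\<^sub>0 = 1" "inner E\<^sub>0 ?N\<^sub>0 = ?\<rho>"
    using E0(2) by (simp_all add: sgn_orth_proj_in S norm_sgn inner_sgn_orth_proj)
  have \<rho>: "?\<rho> > 0" using E0(2) by simp
  have P\<Phi>0: "orth_proj S \<Phi>\<^sub>0 = (eps * ?\<rho> + \<delta>) *\<^sub>R ?N\<^sub>0"
    using E0(2) by (simp add: \<Phi>\<^sub>0_def add scale orth_proj_of_mem S N0(1) algebra_simps)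
      (simp add: sgn_div_norm)
  have nP\<Phi>0: "norm (orth_proj S \<Phi>\<^sub>0) = eps * ?\<rho> + \<delta>"
    using N0(2) eps \<delta> \<rho> by (simp add: P\<Phi>0)
  \<comment> \<open>The projection is 1-Lipschitz, so its norm cannot drop from
    \<open>eps * ?\<rho> + \<delta>\<close> to \<open>\<delta>\<close> within this radius.\<close>
  have big: "norm (orth_proj S \<Phi>) > \<delta>" if "norm (\<Phi> - \<Phi>\<^sub>0) < eps * ?\<rho>" for \<Phi>
  proof -
    have "norm (orth_proj S \<Phi>\<^sub>0) \<le> norm (orth_proj S \<Phi>) + norm (orth_proj S (\<Phi> - \<Phi>\<^sub>0))"
      unfolding diff by (metis norm_minus_commute norm_triangle_sub)
    with norm_orth_proj_le[OF S, of "\<Phi> - \<Phi>\<^sub>0"] that nP\<Phi>0 show ?thesis by linarith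
  qed
  \<comment> \<open>The supporting half-space touches the body only in
    \<open>\<Phi>\<^sub>0\<close>: a value \<open>g \<Phi> \<le> eps\<close> forces equality in both
    Cauchy-Schwarz estimates below, hence \<open>N = ?N\<^sub>0\<close> and
    \<open>V = eps *\<^sub>R E\<^sub>0\<close>.\<close>
  have out: "g \<Phi> > eps" if ge: "inner E\<^sub>0 (\<Phi> - \<Phi>\<^sub>0) \<ge> 0" and ne: "\<Phi> \<noteq> \<Phi>\<^sub>0" and nz: "orth_proj S \<Phi> \<noteq> 0" for \<Phi>
  proof (rule ccontr)
    assume "\<not> g \<Phi> > eps"
    define N where "N = sgn (orth_proj S \<Phi>)"
    define V where "V = \<Phi> - \<delta> *\<^sub>R N"
    have N: "N \<in> S" "norm N = 1" using nz by (simp_all add: N_def sgn_orth_proj_in S norm_sgn)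
    have V: "norm V \<le> eps" using \<open>\<not> g \<Phi> > eps\<close> by (simp add: g_def V_def N_def)
    have EN: "inner E\<^sub>0 N = ?\<rho> * inner ?N\<^sub>0 N"
    proof -
      have "inner E\<^sub>0 N = inner (orth_proj S E\<^sub>0) N" using inner_orth_proj[OF S N(1)] by simp
      also have "orth_proj S E\<^sub>0 = ?\<rho> *\<^sub>R ?N\<^sub>0" using E0(2) by (simp add: sgn_div_norm)
      finally show ?thesis by simp
    qed
    have NN: "inner ?N\<^sub>0 N \<le> 1" using norm_cauchy_schwarz[of ?N\<^sub>0 N] N N0 by simp
    have EV: "inner E\<^sub>0 V \<le> norm V" using norm_cauchy_schwarz[of E\<^sub>0 V] E0 by simp
    have "inner E\<^sub>0 \<Phi>\<^sub>0 = eps + \<delta> * ?\<rho>"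
      using E0(1) N0(3) by (simp add: \<Phi>\<^sub>0_def inner_add_right flip: power2_norm_eq_inner)
    moreover have "inner E\<^sub>0 \<Phi> = inner E\<^sub>0 V + \<delta> * ?\<rho> * inner ?N\<^sub>0 N"
      using EN by (simp add: V_def inner_diff_right)
    ultimately have *: "eps + \<delta> * ?\<rho> \<le> inner E\<^sub>0 V + \<delta> * ?\<rho> * inner ?N\<^sub>0 N"
      using ge by (simp add: inner_diff_right)
    have "\<delta> * ?\<rho> * inner ?N\<^sub>0 N \<le> \<delta> * ?\<rho>" using NN \<delta> \<rho> by (simp add: mult_left_le)
    with * EV V have EVeq: "inner E\<^sub>0 V = eps" "norm V = eps" and "\<delta> * ?\<rho> \<le> \<delta> * ?\<rho> * inner ?N\<^sub>0 N"
      by linarith+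
    then have NNeq: "inner ?N\<^sub>0 N = 1" using NN \<delta> \<rho> by simp
    have "(norm (N - ?N\<^sub>0))\<^sup>2 = (norm N)\<^sup>2 + (norm ?N\<^sub>0)\<^sup>2 - 2 * inner ?N\<^sub>0 N"
      by (simp add: power2_norm_eq_inner inner_diff inner_commute)
    then have "N = ?N\<^sub>0" using NNeq N N0 by simp
    have "(norm (V - eps *\<^sub>R E\<^sub>0))\<^sup>2 = (norm V)\<^sup>2 + eps\<^sup>2 * (norm E\<^sub>0)\<^sup>2 - 2 * eps * inner E\<^sub>0 V"
      unfolding power2_norm_eq_inner
      by (simp add: inner_diff inner_commute power2_eq_square algebra_simps)
    then have "V = eps *\<^sub>R E\<^sub>0" using EVeq E0 by (simp add: power2_eq_square)
    with \<open>N = ?N\<^sub>0\<close> have "\<Phi> = \<Phi>\<^sub>0" by (simp add: V_def \<Phi>\<^sub>0_def algebra_simps)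
    with ne show False by simp
  qed
  have lim: "((\<lambda>t. \<Phi>\<^sub>0 + t *\<^sub>R X) \<longlongrightarrow> \<Phi>\<^sub>0 + 0 *\<^sub>R X) (at_right 0)" for X :: "complex ^ 'n ^ 'n"
    by (intro tendsto_intros)
  define I where "I = \<Theta> + b *\<^sub>R D"
  \<comment> \<open>The negative term \<open>2 * eps * inner E\<^sub>0 I\<close> outweighs
    \<open>t * (norm I)\<^sup>2\<close> for small \<open>t\<close>, which later makes
    \<open>eps *\<^sub>R E\<^sub>0 + t *\<^sub>R I\<close> shorter than \<open>eps\<close>.\<close>
  have "((\<lambda>t. 2 * eps * inner E\<^sub>0 I + t * (norm I)\<^sup>2) \<longlongrightarrow> 2 * eps * inner E\<^sub>0 I + 0 * (norm I)\<^sup>2) (at_right 0)"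
    by (intro tendsto_intros)
  moreover have "2 * eps * inner E\<^sub>0 I + 0 * (norm I)\<^sup>2 < 0"
    using inside eps by (simp add: I_def mult_pos_neg)
  ultimately have ev1: "\<forall>\<^sub>F t in at_right 0. 2 * eps * inner E\<^sub>0 I + t * (norm I)\<^sup>2 < 0"
    by (rule order_tendstoD(2))
  \<comment> \<open>Every \<open>s\<close> between \<open>b * t\<close> and \<open>a * t\<close>
    satisfies \<open>\<bar>s\<bar> \<le> ?m * t\<close>, so the bound on \<open>t\<close> obtained
    here keeps the whole segment in the range of \<open>big\<close>.\<close>
  let ?m = "\<bar>a\<bar> + \<bar>b\<bar>"
  have "((\<lambda>t. t * (norm \<Theta> + ?m * norm D)) \<longlongrightarrow> 0 * (norm \<Theta> + ?m * norm D)) (at_right 0)"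
    by (intro tendsto_intros)
  moreover have "0 * (norm \<Theta> + ?m * norm D) < eps * ?\<rho>"
    using eps \<rho> by simp
  ultimately have ev2: "\<forall>\<^sub>F t in at_right 0. t * (norm \<Theta> + ?m * norm D) < eps * ?\<rho>"
    by (rule order_tendstoD(2))
  show ?thesis
    using ev1 ev2 eventually_at_right_less[of 0]
  proof eventually_elim
    case (elim t)
    let ?\<Phi> = "\<lambda>s. \<Phi>\<^sub>0 + t *\<^sub>R \<Theta> + s *\<^sub>R D"
    have near: "norm (orth_proj S (?\<Phi> s)) > \<delta>" if "b * t \<le> s" "s \<le> a * t" for s
    proof (rule big)
      have "\<bar>b * t\<bar> \<le> ?m * t" "\<bar>a * t\<bar> \<le> ?m * t"
        using elim(3) by (simp_all add: abs_mult distrib_right)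
      then have "\<bar>s\<bar> \<le> ?m * t" using that by linarith
      then have "norm (t *\<^sub>R \<Theta> + s *\<^sub>R D) \<le> t * norm \<Theta> + (?m * t) * norm D"
        using elim(3) by (intro norm_triangle_le add_mono) (simp_all add: mult_right_mono)
      also have "\<dots> = t * (norm \<Theta> + ?m * norm D)" by (simp add: algebra_simps)
      finally show "norm (?\<Phi> s - \<Phi>\<^sub>0) < eps * ?\<rho>" using elim(2) by (simp add: add.assoc)
    qed
    have bat: "b * t < a * t" using ba elim(3) by simp
    have nz: "orth_proj S (?\<Phi> s) \<noteq> 0" if "b * t \<le> s" "s \<le> a * t" for s
      using near[OF that] \<delta> by auto
    have eqa: "?\<Phi> (a * t) = \<Phi>\<^sub>0 + t *\<^sub>R (\<Theta> + a *\<^sub>R D)" and eqb: "?\<Phi> (b * t) = \<Phi>\<^sub>0 + t *\<^sub>R I"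
      by (simp_all add: I_def algebra_simps)
    have ga: "g (?\<Phi> (a * t)) > eps"
    proof (rule out)
      show "inner E\<^sub>0 (?\<Phi> (a * t) - \<Phi>\<^sub>0) \<ge> 0" unfolding eqa using outside(1) elim(3) by simp
      show "?\<Phi> (a * t) \<noteq> \<Phi>\<^sub>0" unfolding eqa using outside(2) elim(3) by simp
    qed (use nz bat in simp)
    have gb: "g (?\<Phi> (b * t)) < eps"
    proof -
      have "(norm (eps *\<^sub>R E\<^sub>0 + t *\<^sub>R I))\<^sup>2
          = eps\<^sup>2 * (norm E\<^sub>0)\<^sup>2 + t * (2 * eps * inner E\<^sub>0 I + t * (norm I)\<^sup>2)"
        unfolding power2_norm_eq_inner
        by (simp add: inner_add inner_commute power2_eq_square algebra_simps)
      also have "\<dots> < eps\<^sup>2"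
        unfolding E0(1) power_one mult_1_right by (rule add_less_same_cancel1[THEN iffD2, OF mult_pos_neg[OF elim(3,1)]])
      finally have lt: "norm (eps *\<^sub>R E\<^sub>0 + t *\<^sub>R I) < eps"
        by (rule power2_less_imp_less[OF _ less_imp_le[OF eps]])
      \<comment> \<open>Replacing the optimal unit matrix by \<open>?N\<^sub>0\<close> can only
        increase the distance.\<close>
      have "g (?\<Phi> (b * t)) \<le> norm (?\<Phi> (b * t) - \<delta> *\<^sub>R ?N\<^sub>0)"
        unfolding g_def using nz[of "b * t"] bat \<delta> by (intro norm_diff_sgn_orth_proj_le S N0) auto
      also have "?\<Phi> (b * t) - \<delta> *\<^sub>R ?N\<^sub>0 = eps *\<^sub>R E\<^sub>0 + t *\<^sub>R I"
        unfolding eqb by (simp add: \<Phi>\<^sub>0_def)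
      also note lt
      finally show ?thesis .
    qed
    have "continuous_on {b * t..a * t} (\<lambda>s. orth_proj S (?\<Phi> s))"
      by (intro linear_continuous_on_compose[OF _ linear_axioms] continuous_intros)
    then have "continuous_on {b * t..a * t} (\<lambda>s. g (?\<Phi> s))"
      unfolding g_def using nz by (intro continuous_intros) auto
    with ga gb bat obtain s where s: "b * t \<le> s" "s \<le> a * t" "g (?\<Phi> s) = eps"
      using IVT'[of "\<lambda>s. g (?\<Phi> s)" "b * t" eps "a * t"] by auto
    then have "b * t < s" "s < a * t" using ga gb by (auto simp: order_less_le)
    moreover obtain E where "norm E = 1" "orth_proj S E \<noteq> 0" "?\<Phi> s = eps *\<^sub>R E + \<delta> *\<^sub>R sgn (orth_proj S E)"
      using coupled_sphere_member[OF S eps \<delta> near[OF s(1,2)]] s(3) unfolding g_def by blast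
    ultimately show ?case by (intro exI[of _ s] exI[of _ E]) simp
  qed
qed

subsection \<open>Optimal perturbations\<close>

text \<open>The locale itself does not tie the bound \<open>a\<close> to \<open>M\<close>; lemmas
  assume \<open>Re l = a\<close> for an eigenvalue \<open>l\<close> of \<open>M\<close>, which
  expresses that \<open>E\<^sub>0\<close> is optimal.\<close>

locale coupled_maximum =
  fixes S :: "(complex ^ 'n ^ 'n) set" and A E\<^sub>0 M :: "complex ^ 'n ^ 'n" and eps \<delta> a :: real
  assumes S: "subspace S" and eps: "eps > 0" and \<delta>: "\<delta> > 0"
    and norm_E0: "norm E\<^sub>0 = 1" and proj_E0: "orth_proj S E\<^sub>0 \<noteq> 0"
    and M: "M = A + eps *\<^sub>R E\<^sub>0 + \<delta> *\<^sub>R sgn (orth_proj S E\<^sub>0)"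
    and max: "\<And>E m. norm E = 1 \<Longrightarrow> orth_proj S E \<noteq> 0 \<Longrightarrow>
      eigenvalue (A + eps *\<^sub>R E + \<delta> *\<^sub>R sgn (orth_proj S E)) m \<Longrightarrow> Re m \<le> a"
begin

text \<open>A step along \<open>\<Theta>\<close> may leave the surface. A correction along
  \<open>D\<close> of controlled size returns to it, and there optimality bounds all
  eigenvalues.\<close>

lemma perturbation:
  assumes "inner E\<^sub>0 (\<Theta> + c *\<^sub>R D) < 0" "inner E\<^sub>0 (\<Theta> + d *\<^sub>R D) \<ge> 0" "\<Theta> + d *\<^sub>R D \<noteq> 0"
    and "c < d" "e > 0"
  shows "\<exists>t s. 0 < t \<and> t < e \<and> c * t < s \<and> s < d * t \<and>
    (\<forall>m. eigenvalue (M + t *\<^sub>R \<Theta> + s *\<^sub>R D) m \<longrightarrow> Re m \<le> a)"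
proof -
  have "\<forall>\<^sub>F t in at_right 0. t \<in> {0<..<e}"
    using \<open>e > 0\<close> by (intro eventually_at_rightI[of 0 e]) auto
  with coupled_sphere_hit[OF S eps \<delta> norm_E0 proj_E0 assms(1-4)]
  have "\<forall>\<^sub>F t in at_right 0. t \<in> {0<..<e} \<and> (\<exists>s E. c * t < s \<and> s < d * t \<and> norm E = 1 \<and>
    orth_proj S E \<noteq> 0 \<and> eps *\<^sub>R E + \<delta> *\<^sub>R sgn (orth_proj S E) =
      eps *\<^sub>R E\<^sub>0 + \<delta> *\<^sub>R sgn (orth_proj S E\<^sub>0) + t *\<^sub>R \<Theta> + s *\<^sub>R D)"
    by eventually_elim auto
  from eventually_happens'[OF trivial_limit_at_right_real this]
  obtain t s E where ts: "0 < t" "t < e" "c * t < s" "s < d * t"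
    and E: "norm E = 1" "orth_proj S E \<noteq> 0" "eps *\<^sub>R E + \<delta> *\<^sub>R sgn (orth_proj S E) =
      eps *\<^sub>R E\<^sub>0 + \<delta> *\<^sub>R sgn (orth_proj S E\<^sub>0) + t *\<^sub>R \<Theta> + s *\<^sub>R D"
    unfolding greaterThanLessThan_iff by blast
  have "A + eps *\<^sub>R E + \<delta> *\<^sub>R sgn (orth_proj S E) = M + t *\<^sub>R \<Theta> + s *\<^sub>R D"
    using E(3) by (simp add: M add.assoc)
  with max[OF E(1,2)] ts show ?thesis by (intro exI[of _ t] exI[of _ s]) simp
qed

text \<open>If \<open>D\<close>, the part of \<open>E\<^sub>0\<close> annihilated by \<open>z\<close>, were nonzero, then \<open>z\<close> would be a left
  eigenvector of \<open>M + t *\<^sub>R mat 1 + s *\<^sub>R D\<close> to the eigenvalue \<open>l + t\<close>, further to the right.\<close>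

lemma left_eigenvector_imp_rank_one:
  assumes z: "left_eigenvector M l z" and l: "Re l = a"
  shows "\<exists>w. E\<^sub>0 = outer z w"
proof -
  have nz: "z \<noteq> 0" and eq: "\<And>v. cdot z (M *v v) = l * cdot z v"
    using z by (simp_all add: left_eigenvector_iff)
  \<comment> \<open>This choice makes all columns of \<open>D\<close> orthogonal to
    \<open>z\<close>.\<close>
  define w where "w = (1 / (norm z)\<^sup>2) *\<^sub>R (ctranspose E\<^sub>0 *v z)"
  define D where "D = E\<^sub>0 - outer z w"
  have adj: "cdot (ctranspose E\<^sub>0 *v z) v = cdot z (E\<^sub>0 *v v)" for v
    unfolding cdot_def ctranspose_def matrix_vector_mult_def map_matrix_def transpose_def
    by (simp add: sum_distrib_left sum_distrib_right algebra_simps) (rule sum.swap)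
  have zD: "cdot z (D *v v) = 0" for v
    using nz by (simp add: D_def matrix_vector_mult_diff_rdistrib outer_vector_mult cdot_diff_right
        cdot_smult_right w_def cdot_scaleR_left adj cdot_self) (simp add: scaleR_conv_of_real)
  \<comment> \<open>Since \<open>D\<close> is orthogonal to \<open>outer z w\<close>, its inner
    product with \<open>E\<^sub>0\<close> is positive unless \<open>D\<close> vanishes, so multiples
    of \<open>D\<close> can cross the tangent hyperplane.\<close>
  have "inner (outer z w) D = 0" by (simp add: inner_outer zD)
  then have ED: "inner E\<^sub>0 D = (norm D)\<^sup>2"
    by (simp add: D_def power2_norm_eq_inner inner_diff_left)
  have "D = 0"
  proof (rule ccontr)
    assume "D \<noteq> 0"
    \<comment> \<open>The slopes are solved for so that the two ends of the segment have inner
      product -1 and 1 with \<open>E\<^sub>0\<close>.\<close>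
    define c where "c = (- inner E\<^sub>0 (mat 1) - 1) / (norm D)\<^sup>2"
    define d where "d = (- inner E\<^sub>0 (mat 1) + 1) / (norm D)\<^sup>2"
    have c: "inner E\<^sub>0 (mat 1 + c *\<^sub>R D) = - 1" and d: "inner E\<^sub>0 (mat 1 + d *\<^sub>R D) = 1"
      using \<open>D \<noteq> 0\<close> by (simp_all add: c_def d_def inner_add_right ED)
    have "c < d" using \<open>D \<noteq> 0\<close> by (simp add: c_def d_def divide_strict_right_mono)
    obtain t s where t: "0 < t" and st: "\<And>m. eigenvalue (M + t *\<^sub>R mat 1 + s *\<^sub>R D) m \<Longrightarrow> Re m \<le> a"
    proof -
      have "mat 1 + d *\<^sub>R D \<noteq> 0" using d by force
      with perturbation[of "mat 1" c D d 1] c d \<open>c < d\<close> show ?thesis by (auto intro: that)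
    qed
    have "left_eigenvector (M + t *\<^sub>R mat 1 + s *\<^sub>R D) (l + of_real t) z"
      using nz by (simp add: left_eigenvector_iff matrix_vector_mult_add_rdistrib cdot_add_right eq
          scaleR_matrix_vector_mult cdot_scaleR_right zD)
        (simp add: scaleR_conv_of_real distrib_right)
    then have "Re (l + of_real t) \<le> a" using st eigenvalue_iff_left_eigenvector by blast
    with l t show False by simp
  qed
  then show ?thesis by (auto simp: D_def)
qed

text \<open>By \<open>left_eigenvector_imp_rank_one\<close>, each of the two left eigenvectors spans
  the column space of the nonzero matrix \<open>E\<^sub>0\<close>, so they are proportional and
  belong to the same eigenvalue.\<close>

lemma left_eigenvector_unique:
  assumes x: "left_eigenvector M l x" "Re l = a" and z: "left_eigenvector M m z" "Re m = a"
  shows "\<exists>c. z = c *s x" "m = l"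
proof -
  obtain v w where v: "E\<^sub>0 = outer x v" and w: "E\<^sub>0 = outer z w"
    using left_eigenvector_imp_rank_one[OF x] left_eigenvector_imp_rank_one[OF z] by blast
  have "w \<noteq> 0" using w norm_E0 by (auto simp: norm_outer)
  then obtain j where j: "w $ j \<noteq> 0" by (auto simp: vec_eq_iff)
  have "z $ i * cnj (w $ j) = x $ i * cnj (v $ j)" for i
    using v w by (simp add: outer_def vec_eq_iff)
  with j have "z = (cnj (v $ j) / cnj (w $ j)) *s x"
    by (simp add: vec_eq_iff field_simps)
  then show "\<exists>c. z = c *s x" ..
  then obtain c where c: "z = c *s x" by blast
  have "z \<noteq> 0" using z by (simp add: left_eigenvector_def)
  then have "left_eigenvector M l z"
    using x left_eigenvector_smult c by auto
  then have "m * cdot z z = l * cdot z z"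
    using z unfolding left_eigenvector_iff by metis
  moreover have "cdot z z \<noteq> 0" using \<open>z \<noteq> 0\<close> by (simp add: cdot_self)
  ultimately show "m = l" by simp
qed

lemma first_order_bound:
  assumes x: "left_eigenvector M l x" and y: "right_eigenvector M l y" and l: "Re l = a"
    and xy: "cdot x y \<noteq> 0" and X: "X \<longlonglongrightarrow> M" and \<tau>: "\<And>k. \<tau> k > 0"
    and max: "\<And>k m. eigenvalue (X k) m \<Longrightarrow> Re m \<le> a"
    and u: "(\<lambda>k. (1 / \<tau> k) *\<^sub>R ((X k - M) *v y)) \<longlonglongrightarrow> u"
  shows "Re (cdot x u / cdot x y) \<le> 0"
proof (rule eigenvalue_first_order_bound[OF X \<tau> _ _ _ xy u])
  show "Re m \<le> Re l" if "eigenvalue (X k) m" for k m using max[OF that] l by simp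
  show "\<exists>c. z = c *s x" if "left_eigenvector M l z" for z
    by (rule left_eigenvector_unique(1)[OF x l that l])
  show "M *v y = l *s y" using y by (simp add: right_eigenvector_def)
qed

text \<open>If the tangential part \<open>\<Theta>\<close> of \<open>outer x y\<close> were nonzero,
  moving along it would raise the real part to first order, because
  \<open>inner (outer x y) \<Theta> = inner \<Theta> \<Theta>\<close>. Equal norms then leave only
  the sign open.\<close>

lemma outer_eq_pm:
  assumes x: "left_eigenvector M l x" "norm x = 1" and y: "right_eigenvector M l y" "norm y = 1"
    and l: "Re l = a" and real: "cdot x y \<in> \<real>" and pos: "Re (cdot x y) > 0"
  shows "outer x y = E\<^sub>0 \<or> outer x y = - E\<^sub>0"
proof -
  define \<nu> where "\<nu> = inner (outer x y) E\<^sub>0"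
  define \<Theta> where "\<Theta> = outer x y - \<nu> *\<^sub>R E\<^sub>0"
  have EE: "inner E\<^sub>0 E\<^sub>0 = 1" using norm_E0 by (simp flip: power2_norm_eq_inner)
  have E\<Theta>: "inner E\<^sub>0 \<Theta> = 0" by (simp add: \<Theta>_def \<nu>_def inner_diff_right EE inner_commute)
  \<comment> \<open>The slopes \<open>q k\<close> shrink to 0, so the correction \<open>s k\<close>
    is of smaller order than \<open>t k\<close> and disappears from the first-order term.\<close>
  define q :: "nat \<Rightarrow> real" where "q k = 1 / real (Suc k)" for k
  have q: "q k > 0" for k by (simp add: q_def)
  have q0: "q \<longlonglongrightarrow> 0" unfolding q_def by (rule lim_1_over_n[THEN LIMSEQ_Suc])
  have "\<exists>t s. 0 < t \<and> t < q k \<and> - q k * t < s \<and> s < q k * t \<and>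
      (\<forall>m. eigenvalue (M + t *\<^sub>R \<Theta> + s *\<^sub>R E\<^sub>0) m \<longrightarrow> Re m \<le> a)" for k
  proof -
    have i: "inner E\<^sub>0 (\<Theta> + r *\<^sub>R E\<^sub>0) = r" for r by (simp add: inner_add_right E\<Theta> EE)
    have "\<Theta> + q k *\<^sub>R E\<^sub>0 \<noteq> 0" using i[of "q k"] q[of k] by force
    then show ?thesis
      using q[of k] by (intro perturbation) (simp_all add: i i[of "- q k", simplified])
  qed
  then obtain t s where t: "\<And>k. 0 < t k" "\<And>k. t k < q k"
    and s: "\<And>k. - q k * t k < s k" "\<And>k. s k < q k * t k"
    and mx: "\<And>k m. eigenvalue (M + t k *\<^sub>R \<Theta> + s k *\<^sub>R E\<^sub>0) m \<Longrightarrow> Re m \<le> a"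
    by metis
  have t0: "t \<longlonglongrightarrow> 0"
    by (rule tendsto_sandwich[OF _ _ tendsto_const q0]) (auto intro!: always_eventually less_imp_le t)
  have st: "\<bar>s k / t k\<bar> \<le> q k" for k
  proof -
    have "\<bar>s k\<bar> \<le> q k * t k" using s[of k] by linarith
    then show ?thesis using t(1)[of k] by (simp add: abs_divide pos_divide_le_eq)
  qed
  have st0: "(\<lambda>k. s k / t k) \<longlonglongrightarrow> 0"
    by (rule Lim_null_comparison[OF _ q0]) (use st in auto)
  have s0: "s \<longlonglongrightarrow> 0"
    using tendsto_mult[OF st0 t0] t(1) by (simp add: less_imp_neq[symmetric])
  have "(\<lambda>k. M + t k *\<^sub>R \<Theta> + s k *\<^sub>R E\<^sub>0) \<longlonglongrightarrow> M + 0 *\<^sub>R \<Theta> + 0 *\<^sub>R E\<^sub>0"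
    by (intro tendsto_intros t0 s0)
  then have X: "(\<lambda>k. M + t k *\<^sub>R \<Theta> + s k *\<^sub>R E\<^sub>0) \<longlonglongrightarrow> M" by simp
  have "(\<lambda>k. \<Theta> *v y + (s k / t k) *\<^sub>R (E\<^sub>0 *v y)) \<longlonglongrightarrow> \<Theta> *v y + 0 *\<^sub>R (E\<^sub>0 *v y)"
    by (intro tendsto_intros st0)
  moreover have "(1 / t k) *\<^sub>R ((M + t k *\<^sub>R \<Theta> + s k *\<^sub>R E\<^sub>0 - M) *v y) = \<Theta> *v y + (s k / t k) *\<^sub>R (E\<^sub>0 *v y)" for k
    using t(1)[of k]
    by (simp add: matrix_vector_mult_add_rdistrib scaleR_matrix_vector_mult scaleR_add_right)
  ultimately have u: "(\<lambda>k. (1 / t k) *\<^sub>R ((M + t k *\<^sub>R \<Theta> + s k *\<^sub>R E\<^sub>0 - M) *v y)) \<longlonglongrightarrow> \<Theta> *v y"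
    by simp
  have ne: "cdot x y \<noteq> 0" using pos by auto
  have "Re (cdot x (\<Theta> *v y) / cdot x y) \<le> 0"
    by (rule first_order_bound[OF x(1) y(1) l ne X t(1) mx u])
  moreover have "cdot x y = of_real (Re (cdot x y))" using real by simp
  ultimately have "Re (cdot x (\<Theta> *v y)) \<le> 0"
    using pos by (metis Re_divide_of_real divide_le_0_iff not_le)
  then have "inner (outer x y) \<Theta> \<le> 0" by (simp add: inner_outer)
  then have "inner \<Theta> \<Theta> \<le> 0"
    using E\<Theta> by (simp add: \<Theta>_def inner_diff_left)
  then have "\<Theta> = 0" by (metis inner_ge_zero inner_eq_zero_iff order_antisym)
  then have \<nu>: "outer x y = \<nu> *\<^sub>R E\<^sub>0" by (simp add: \<Theta>_def)
  moreover have "\<bar>\<nu>\<bar> = 1"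
    using arg_cong[OF \<nu>, of norm] x(2) y(2) norm_E0 by (simp add: norm_outer)
  ultimately show ?thesis by (auto simp: abs_if split: if_splits)
qed

text \<open>If \<open>outer x y = - E\<^sub>0\<close>, then curving back from a tangent line to the sphere moves the
  eigenvalue to the right. The tangent direction \<open>\<Theta>\<close> is chosen such that it does not move the
  eigenvalue itself: it annihilates \<open>y\<close> or, if \<open>x\<close> and \<open>y\<close> are parallel, it shifts the eigenvalue
  in the imaginary direction.\<close>

lemma outer_eq:
  assumes x: "left_eigenvector M l x" "norm x = 1" and y: "right_eigenvector M l y" "norm y = 1"
    and l: "Re l = a" and real: "cdot x y \<in> \<real>" and pos: "Re (cdot x y) > 0"
  shows "outer x y = E\<^sub>0"
proof (rule ccontr)
  assume "outer x y \<noteq> E\<^sub>0"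
  with outer_eq_pm[OF assms] have E0: "E\<^sub>0 = - outer x y" by (metis minus_minus)
  \<comment> \<open>Here \<open>\<kappa>\<close> is the inner product itself, the reciprocal of the
    \<open>kappa\<close> in the final formula.\<close>
  define \<kappa> where "\<kappa> = Re (cdot x y)"
  have xy: "cdot x y = of_real \<kappa>" and yx: "cdot y x = of_real \<kappa>"
    using real cnj_cdot[of x y] Reals_cnj_iff[of "cdot x y"] by (simp_all add: \<kappa>_def)
  have \<kappa>: "\<kappa> > 0" using pos by (simp add: \<kappa>_def)
  have xx: "cdot x x = 1" and yy: "cdot y y = 1" using x y by (simp_all add: cdot_self)
  have E0y: "E\<^sub>0 *v y = - x"
    using yy matrix_vector_mult_diff_rdistrib[of 0 "outer x y" y] by (simp add: E0 outer_vector_mult)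
  have EE: "inner E\<^sub>0 E\<^sub>0 = 1" using norm_E0 by (simp flip: power2_norm_eq_inner)
  have My: "M *v y = l *s y" using y by (simp add: right_eigenvector_def)
  \<comment> \<open>A nonzero tangential step already leads outside the body, so 0 can serve as
    upper slope and the correction \<open>s\<close> along the normal is strictly negative.\<close>
  have pert: "\<exists>t s. 0 < t \<and> t < e \<and> - t < s \<and> s < 0 \<and>
      (\<forall>m. eigenvalue (M + t *\<^sub>R \<Theta> + s *\<^sub>R E\<^sub>0) m \<longrightarrow> Re m \<le> a)"
    if "inner E\<^sub>0 \<Theta> = 0" "\<Theta> \<noteq> 0" "e > 0" for \<Theta> and e :: real
    using perturbation[of \<Theta> "- 1" E\<^sub>0 0 e] that by (simp add: inner_diff_right EE)
  \<comment> \<open>This is the component of \<open>x\<close> orthogonal to the unit vector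
    \<open>y\<close>.\<close>
  define v where "v = x - of_real \<kappa> *s y"
  show False
  proof (cases "v = 0")
    case True
    then have x_eq: "x = of_real \<kappa> *s y" by (simp add: v_def)
    have "inner E\<^sub>0 (outer (\<i> *s x) y) = - inner (outer x y) (outer (\<i> *s x) y)" by (simp add: E0)
    also have "\<dots> = 0"
      by (simp add: inner_outer outer_vector_mult yy cdot_smult_right xx)
    finally have "inner E\<^sub>0 (outer (\<i> *s x) y) = 0" .
    moreover have "outer (\<i> *s x) y \<noteq> 0"
      using x y norm_outer[of "\<i> *s x" y] by (auto simp: norm_smult)
    ultimately obtain t s where s: "s < 0"
      and mx: "\<And>m. eigenvalue (M + t *\<^sub>R outer (\<i> *s x) y + s *\<^sub>R E\<^sub>0) m \<Longrightarrow> Re m \<le> a"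
      using pert[of "outer (\<i> *s x) y" 1] zero_less_one by metis
    \<comment> \<open>Here \<open>y\<close> stays an exact eigenvector, and the real part of its
      eigenvalue grows by \<open>- s * \<kappa>\<close>.\<close>
    have "(M + t *\<^sub>R outer (\<i> *s x) y + s *\<^sub>R E\<^sub>0) *v y = l *s y + t *\<^sub>R (\<i> *s x) - s *\<^sub>R x"
      by (simp add: matrix_vector_mult_add_rdistrib scaleR_matrix_vector_mult My outer_vector_mult yy E0y)
    also have "\<dots> = (l + \<i> * of_real (t * \<kappa>) - of_real (s * \<kappa>)) *s y"
      by (subst (1 2) x_eq) (simp add: vec_eq_iff scaleR_vec_smult algebra_simps)
    finally have "right_eigenvector (M + t *\<^sub>R outer (\<i> *s x) y + s *\<^sub>R E\<^sub>0)
        (l + \<i> * of_real (t * \<kappa>) - of_real (s * \<kappa>)) y"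
      using y(1) unfolding right_eigenvector_def by blast
    then have "Re (l + \<i> * of_real (t * \<kappa>) - of_real (s * \<kappa>)) \<le> a"
      by (intro mx) (auto simp only: eigenvalue_def)
    then have "s * \<kappa> \<ge> 0" using l by simp
    with s \<kappa> show False by (simp add: zero_le_mult_iff)
  next
    case False
    have vy: "cdot v y = 0"
      using cnj_cdot[of y v] by (simp add: v_def cdot_diff_right cdot_smult_right yx yy)
    have \<Theta>y: "outer x v *v y = 0" by (simp add: outer_vector_mult vy)
    have "inner E\<^sub>0 (outer x v) = 0"
      by (simp add: E0 inner_outer \<Theta>y) (simp add: cdot_def)
    moreover have "outer x v \<noteq> 0" using False x(2) by (metis norm_outer mult_1 norm_eq_zero)
    ultimately have "\<exists>t s. 0 < t \<and> t < 1 / real (Suc k) \<and> - t < s \<and> s < 0 \<and>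
      (\<forall>m. eigenvalue (M + t *\<^sub>R outer x v + s *\<^sub>R E\<^sub>0) m \<longrightarrow> Re m \<le> a)" for k
      by (intro pert) auto
    then obtain t s where t: "\<And>k. 0 < t k" "\<And>k. t k < 1 / real (Suc k)"
      and s: "\<And>k. - t k < s k" "\<And>k. s k < 0"
      and mx: "\<And>k m. eigenvalue (M + t k *\<^sub>R outer x v + s k *\<^sub>R E\<^sub>0) m \<Longrightarrow> Re m \<le> a"
      by metis
    have t0: "t \<longlonglongrightarrow> 0"
      by (rule tendsto_sandwich[OF _ _ tendsto_const lim_1_over_n[THEN LIMSEQ_Suc]])
        (intro always_eventually allI less_imp_le t)+
    have "norm (s k) \<le> t k" for k using s[of k] by simp
    then have s0: "s \<longlonglongrightarrow> 0"
      by (intro Lim_null_comparison[OF _ t0] always_eventually allI)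
    have "(\<lambda>k. M + t k *\<^sub>R outer x v + s k *\<^sub>R E\<^sub>0) \<longlonglongrightarrow> M + 0 *\<^sub>R outer x v + 0 *\<^sub>R E\<^sub>0"
      by (intro tendsto_intros t0 s0)
    then have X: "(\<lambda>k. M + t k *\<^sub>R outer x v + s k *\<^sub>R E\<^sub>0) \<longlonglongrightarrow> M" by simp
    \<comment> \<open>As \<open>outer x v\<close> annihilates \<open>y\<close>, only the term in
      \<open>s k\<close> acts on it. Dividing by \<open>- s k\<close> therefore gives a limit
      whatever the ratio of \<open>s k\<close> to \<open>t k\<close>.\<close>
    have "(1 / - s k) *\<^sub>R ((M + t k *\<^sub>R outer x v + s k *\<^sub>R E\<^sub>0 - M) *v y) = x" for k
      using s(2)[of k]
      by (simp add: matrix_vector_mult_add_rdistrib scaleR_matrix_vector_mult \<Theta>y E0y)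
    then have u: "(\<lambda>k. (1 / - s k) *\<^sub>R ((M + t k *\<^sub>R outer x v + s k *\<^sub>R E\<^sub>0 - M) *v y)) \<longlonglongrightarrow> x"
      by simp
    have "Re (cdot x x / cdot x y) \<le> 0"
      by (rule first_order_bound[OF x(1) y(1) l _ X _ mx u]) (use s \<kappa> xy in auto)
    then show False using \<kappa> by (simp add: xx xy Re_divide_of_real divide_le_0_iff)
  qed
qed

end

subsection \<open>Differentiation of the rightmost eigenvalue\<close>

lemma has_vector_derivative_iff_quotient:
  fixes f :: "real \<Rightarrow> 'a :: real_normed_vector"
  shows "(f has_vector_derivative f') (at d) \<longleftrightarrow> ((\<lambda>t. (1 / (t - d)) *\<^sub>R (f t - f d)) \<longlongrightarrow> f') (at d)"
proof -
  have "norm (f t - f d - (t - d) *\<^sub>R f') / norm (t - d) = norm ((1 / (t - d)) *\<^sub>R (f t - f d) - f')"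
    if "t \<noteq> d" for t
  proof -
    have "f t - f d - (t - d) *\<^sub>R f' = (t - d) *\<^sub>R ((1 / (t - d)) *\<^sub>R (f t - f d) - f')"
      using that by (simp add: scaleR_diff_right)
    then show ?thesis using that by simp
  qed
  then have "((\<lambda>t. norm (f t - f d - (t - d) *\<^sub>R f') / norm (t - d)) \<longlongrightarrow> 0) (at d) \<longleftrightarrow>
      ((\<lambda>t. norm ((1 / (t - d)) *\<^sub>R (f t - f d) - f')) \<longlongrightarrow> 0) (at d)"
    by (intro tendsto_cong) (auto simp: eventually_at_filter)
  also have "\<dots> \<longleftrightarrow> ((\<lambda>t. (1 / (t - d)) *\<^sub>R (f t - f d)) \<longlongrightarrow> f') (at d)"
    unfolding tendsto_norm_zero_iff by (rule LIM_zero_iff)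
  finally show ?thesis
    by (simp add: has_vector_derivative_def has_derivative_iff_norm bounded_linear_scaleR_left)
qed

text \<open>Continuity of \<open>lam\<close> at \<open>d\<close> has to be derived first: a limit of
  values of \<open>lam\<close> is an eigenvalue of \<open>M d\<close>, dominance makes its real part
  maximal, and \<open>unique\<close> identifies it as \<open>lam d\<close>. Then
  \<open>eigenvalue_quotient_limit\<close> applies along subsequences.\<close>

lemma dominant_eigenvalue_has_vector_derivative:
  fixes M :: "real \<Rightarrow> complex ^ 'n ^ 'n"
  assumes V: "open V" "d \<in> V" and M': "(M has_vector_derivative M') (at d)"
    and ev: "\<And>t. t \<in> V \<Longrightarrow> eigenvalue (M t) (lam t)"
    and dom: "\<And>t m. t \<in> V \<Longrightarrow> eigenvalue (M t) m \<Longrightarrow> Re m \<le> Re (lam t)"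
    and unique: "\<And>m. eigenvalue (M d) m \<Longrightarrow> Re m = Re (lam d) \<Longrightarrow> m = lam d"
    and left: "\<And>z. left_eigenvector (M d) (lam d) z \<Longrightarrow> \<exists>c. z = c *s x"
    and y: "M d *v y = lam d *s y" and xy: "cdot x y \<noteq> 0"
  shows "(lam has_vector_derivative cdot x (M' *v y) / cdot x y) (at d)"
proof -
  let ?L = "cdot x (M' *v y) / cdot x y" and ?q = "\<lambda>t. (lam t - lam d) / of_real (t - d)"
  have quot: "((\<lambda>t. (1 / (t - d)) *\<^sub>R (M t - M d)) \<longlongrightarrow> M') (at d)"
    using M' by (simp only: has_vector_derivative_iff_quotient)
  have cont: "(M \<longlongrightarrow> M d) (at d)"
    using M' has_vector_derivative_continuous isCont_def by blast
  have sub: "\<exists>r. strict_mono r \<and> (\<lambda>k. ?q (X (r k))) \<longlonglongrightarrow> ?L"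
    if XV: "\<And>k. X k \<in> V" and Xd: "\<And>k. X k \<noteq> d" and X: "X \<longlonglongrightarrow> d" for X :: "nat \<Rightarrow> real"
  proof -
    have atX: "filterlim X (at d) sequentially"
      using X Xd by (simp add: filterlim_at)
    have MX: "(\<lambda>k. M (X k)) \<longlonglongrightarrow> M d" and
      qX: "(\<lambda>k. (1 / (X k - d)) *\<^sub>R (M (X k) - M d)) \<longlonglongrightarrow> M'"
      by (rule filterlim_compose[OF cont atX], rule filterlim_compose[OF quot atX])
    \<comment> \<open>These eigenvalues bound \<open>Re (lam (X k))\<close> from below and converge
      to \<open>lam d\<close>, which excludes a drop of the real part in the limit.\<close>
    obtain m where m: "m \<longlonglongrightarrow> lam d" "\<forall>\<^sub>F k in sequentially. eigenvalue (M (X k)) (m k)"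
      by (rule eigenvalue_approximation[OF MX ev[OF V(2)]])
    obtain C where C: "\<And>N l. eigenvalue (N :: complex ^ 'n ^ 'n) l \<Longrightarrow> norm l \<le> C * norm N"
      using eigenvalue_norm_bound by blast
    obtain B where B: "\<And>k. norm (C * norm (M (X k))) \<le> B"
      using convergent_imp_Bseq[OF convergentI[OF tendsto_mult_left[OF tendsto_norm[OF MX], of C]]]
      by (auto simp: Bseq_def)
    have "norm (lam (X k)) \<le> B" for k
      using C[OF ev[OF XV[of k]]] B[of k] by simp
    then have "bounded (range (\<lambda>k. lam (X k)))" by (auto simp: bounded_iff)
    then obtain l r where r: "strict_mono (r :: nat \<Rightarrow> nat)" and l0: "((\<lambda>k. lam (X k)) \<circ> r) \<longlonglongrightarrow> l"
      using bounded_imp_convergent_subsequence by blast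
    have l: "(\<lambda>k. lam (X (r k))) \<longlonglongrightarrow> l" using l0 by (simp add: o_def)
    have MXr: "(\<lambda>k. M (X (r k))) \<longlonglongrightarrow> M d" and mr: "(\<lambda>k. m (r k)) \<longlonglongrightarrow> lam d"
      and qXr: "(\<lambda>k. (1 / (X (r k) - d)) *\<^sub>R (M (X (r k)) - M d)) \<longlonglongrightarrow> M'"
      using LIMSEQ_subseq_LIMSEQ[OF MX r] LIMSEQ_subseq_LIMSEQ[OF m(1) r] LIMSEQ_subseq_LIMSEQ[OF qX r]
      by (simp_all add: o_def)
    have evl: "eigenvalue (M d) l"
      by (rule eigenvalue_limit[OF MXr l]) (simp_all add: ev XV)
    have "\<forall>\<^sub>F k in sequentially. Re (m (r k)) \<le> Re (lam (X (r k)))"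
      using eventually_subseq[OF r m(2)] by eventually_elim (rule dom[OF XV])
    then have "Re (lam d) \<le> Re l"
      by (intro tendsto_le[OF _ tendsto_Re[OF l] tendsto_Re[OF mr]]) simp_all
    then have "l = lam d" using dom[OF V(2) evl] by (intro unique[OF evl]) simp
    with l have l': "(\<lambda>k. lam (X (r k))) \<longlonglongrightarrow> lam d" by simp
    have "(\<lambda>k. (1 / (X (r k) - d)) *\<^sub>R ((M (X (r k)) - M d) *v y)) \<longlonglongrightarrow> M' *v y"
      using tendsto_matrix_vector_mult[OF qXr tendsto_const[of y]]
      by (simp add: scaleR_matrix_vector_mult)
    from eigenvalue_quotient_limit[OF MXr l' ev[OF XV] left y xy this]
    obtain r' :: "nat \<Rightarrow> nat" where "strict_mono r'" "(\<lambda>k. ?q (X (r (r' k)))) \<longlonglongrightarrow> ?L"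
      by blast
    with r show ?thesis by (intro exI[of _ "r \<circ> r'"]) (simp add: strict_mono_o)
  qed
  \<comment> \<open>Subsequence principle: by \<open>sub\<close>, a sequence of quotients staying
    away from \<open>?L\<close> is impossible.\<close>
  have "(?q \<longlongrightarrow> ?L) (at d within V)"
    unfolding tendsto_at_iff_sequentially
  proof (intro allI impI)
    fix X assume XV: "\<forall>k. X k \<in> V - {d}" and X: "X \<longlonglongrightarrow> d"
    show "(?q \<circ> X) \<longlonglongrightarrow> ?L"
    proof (rule ccontr)
      assume "\<not> (?q \<circ> X) \<longlonglongrightarrow> ?L"
      then obtain e where e: "e > 0" and "\<not> (\<forall>\<^sub>F k in sequentially. dist (?q (X k)) ?L < e)"
        by (auto simp: tendsto_iff)
      then obtain r :: "nat \<Rightarrow> nat" where r: "strict_mono r" and far: "\<And>k. \<not> dist (?q (X (r k))) ?L < e"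
        using not_eventually_sequentiallyD by blast
      have "(\<lambda>k. X (r k)) \<longlonglongrightarrow> d" using LIMSEQ_subseq_LIMSEQ[OF X r] by (simp add: o_def)
      then obtain r' where "(\<lambda>k. ?q (X (r (r' k)))) \<longlonglongrightarrow> ?L"
        using sub[of "\<lambda>k. X (r k)"] XV by blast
      from tendstoD[OF this e] far show False by simp
    qed
  qed
  then have "(?q \<longlongrightarrow> ?L) (at d)" using V by (simp only: at_within_open)
  moreover have "?q t = (1 / (t - d)) *\<^sub>R (lam t - lam d)" for t
    unfolding scaleR_conv_of_real by simp
  ultimately show ?thesis
    by (simp only: has_vector_derivative_iff_quotient)
qed

text \<open>The function \<open>inner (f t) (f t)\<close> is constant near \<open>d\<close>, and its
  derivative there is twice this inner product.\<close>

lemma unit_curve_inner_derivative: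
  fixes f :: "real \<Rightarrow> 'a :: real_inner"
  assumes V: "open V" "d \<in> V" and f': "(f has_vector_derivative f') (at d)"
    and unit: "\<And>t. t \<in> V \<Longrightarrow> norm (f t) = 1"
  shows "inner (f d) f' = 0"
proof -
  have "((\<lambda>t. inner (f t) (f t)) has_vector_derivative (inner (f d) f' + inner f' (f d))) (at d)"
    by (rule bounded_bilinear.has_vector_derivative[OF bounded_bilinear_inner f' f'])
  moreover have "((\<lambda>t. inner (f t) (f t)) has_vector_derivative 0) (at d)"
    by (rule has_vector_derivative_transform_within_open[OF has_vector_derivative_const V])
      (simp add: unit flip: power2_norm_eq_inner)
  ultimately have "inner (f d) f' + inner f' (f d) = 0"
    by (rule vector_derivative_unique_at)
  then show ?thesis by (simp add: inner_commute)
qed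

lemma sgn_curve_derivative:
  fixes f :: "real \<Rightarrow> 'a :: real_inner"
  assumes f': "(f has_vector_derivative f') (at d)" and nz: "f d \<noteq> 0"
  obtains N' where "((\<lambda>t. sgn (f t)) has_vector_derivative N') (at d)"
proof -
  have f: "f differentiable at d" using f' by (rule differentiableI_vector)
  then have "(\<lambda>t. norm (f t)) differentiable at d"
    using differentiable_compose[of norm f d UNIV] differentiable_norm_at[OF nz] by simp
  then have "(\<lambda>t. inverse (norm (f t)) *\<^sub>R f t) differentiable at d"
    using nz f by (intro differentiable_scaleR differentiable_inverse) auto
  then show ?thesis
    using that unfolding vector_derivative_works sgn_div_norm by blast
qed

theorem theorem7p2:
  fixes S :: "(complex ^ 'n ^ 'n) set"
    and A :: "complex ^ 'n ^ 'n"
    and eps delta_eps :: real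
    and E M :: "real \<Rightarrow> complex ^ 'n ^ 'n"
    and phi eta kappa :: "real \<Rightarrow> real"
    and lam :: "real \<Rightarrow> complex"
    and x y :: "real \<Rightarrow> complex ^ 'n"
  assumes S: "subspace S"
    and A_stable: "\<And>l. eigenvalue A l \<Longrightarrow> Re l < 0"
    and eps: "0 < eps" "eps < stability_radius A"
    and E_argmin: "\<And>\<delta>. \<delta> > 0 \<Longrightarrow>
      is_arg_min (F_tilde S A eps \<delta>) (\<lambda>E'. norm E' = 1 \<and> orth_proj S E' \<noteq> 0) (E \<delta>)"
    and phi: "\<And>\<delta>. \<delta> > 0 \<Longrightarrow> phi \<delta> = F_tilde S A eps \<delta> (E \<delta>)"
    and delta_eps: "delta_eps > 0" "phi delta_eps = 0"
      "\<And>\<delta>. 0 < \<delta> \<Longrightarrow> \<delta> < delta_eps \<Longrightarrow> phi \<delta> \<noteq> 0"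
    and eta: "\<And>\<delta>. \<delta> > 0 \<Longrightarrow> eta \<delta> = 1 / norm (orth_proj S (E \<delta>))"
    and M: "\<And>\<delta>. \<delta> > 0 \<Longrightarrow>
      M \<delta> = A + eps *\<^sub>R E \<delta> + (\<delta> * eta \<delta>) *\<^sub>R orth_proj S (E \<delta>)"
    and lam: "\<And>\<delta>. \<delta> > 0 \<Longrightarrow> lam \<delta> = rightmost_eigenvalue (M \<delta>)"
    and simple: "\<forall>\<^sub>F \<delta> in nhds delta_eps. simple_eigenvalue (M \<delta>) (lam \<delta>)"
    and E_C1: "\<exists>U. open U \<and> delta_eps \<in> U \<and> E C1_differentiable_on U"
    and x: "\<forall>\<^sub>F \<delta> in nhds delta_eps. left_eigenvector (M \<delta>) (lam \<delta>) (x \<delta>) \<and> norm (x \<delta>) = 1"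
    and y: "\<forall>\<^sub>F \<delta> in nhds delta_eps. right_eigenvector (M \<delta>) (lam \<delta>) (y \<delta>) \<and> norm (y \<delta>) = 1"
    and xy: "\<forall>\<^sub>F \<delta> in nhds delta_eps.
      cdot (x \<delta>) (y \<delta>) \<in> \<real> \<and> Re (cdot (x \<delta>) (y \<delta>)) > 0"
    and kappa: "\<forall>\<^sub>F \<delta> in nhds delta_eps. kappa \<delta> = 1 / Re (cdot (x \<delta>) (y \<delta>))"
  shows "\<exists>V. open V \<and> delta_eps \<in> V \<and>
    (\<forall>\<delta>\<in>V. phi \<delta> = - Re (lam \<delta>)) \<and>
    phi C1_differentiable_on V \<and>
    (\<forall>\<delta>\<in>V. (phi has_real_derivative
      - kappa \<delta> * norm (orth_proj S (outer (x \<delta>) (y \<delta>)))) (at \<delta>))"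
proof -

  \<comment> \<open>A common neighbourhood for the local assumptions\<close>
  from E_C1 obtain U where U: "open U" "delta_eps \<in> U" "E C1_differentiable_on U" by blast
  have "\<forall>\<^sub>F t in nhds delta_eps. t \<in> U \<and> t > 0"
    using eventually_nhds_in_open[OF U(1,2)] eventually_nhds_in_open[OF open_greaterThan, of delta_eps 0]
      delta_eps(1) by (auto elim: eventually_elim2)
  with x y xy kappa have "\<forall>\<^sub>F t in nhds delta_eps. t \<in> U \<and> t > 0 \<and>
      (left_eigenvector (M t) (lam t) (x t) \<and> norm (x t) = 1) \<and>
      (right_eigenvector (M t) (lam t) (y t) \<and> norm (y t) = 1) \<and>
      (cdot (x t) (y t) \<in> \<real> \<and> Re (cdot (x t) (y t)) > 0) \<and>
      kappa t = 1 / Re (cdot (x t) (y t))"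
    by eventually_elim auto
  then obtain V where V: "open V" "delta_eps \<in> V" and VP: "\<And>t. t \<in> V \<Longrightarrow> t \<in> U \<and> t > 0 \<and>
      (left_eigenvector (M t) (lam t) (x t) \<and> norm (x t) = 1) \<and>
      (right_eigenvector (M t) (lam t) (y t) \<and> norm (y t) = 1) \<and>
      (cdot (x t) (y t) \<in> \<real> \<and> Re (cdot (x t) (y t)) > 0) \<and>
      kappa t = 1 / Re (cdot (x t) (y t))"
    unfolding eventually_nhds by blast
  from VP have pos: "\<And>t. t \<in> V \<Longrightarrow> t > 0"
    and xV: "\<And>t. t \<in> V \<Longrightarrow> left_eigenvector (M t) (lam t) (x t)" "\<And>t. t \<in> V \<Longrightarrow> norm (x t) = 1"
    and yV: "\<And>t. t \<in> V \<Longrightarrow> right_eigenvector (M t) (lam t) (y t)" "\<And>t. t \<in> V \<Longrightarrow> norm (y t) = 1"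
    and xyV: "\<And>t. t \<in> V \<Longrightarrow> cdot (x t) (y t) \<in> \<real>" "\<And>t. t \<in> V \<Longrightarrow> Re (cdot (x t) (y t)) > 0"
    and kappaV: "\<And>t. t \<in> V \<Longrightarrow> kappa t = 1 / Re (cdot (x t) (y t))"
    by blast+

  \<comment> \<open>Optimality at each parameter value\<close>
  let ?P = "orth_proj S"
  have E: "norm (E t) = 1" "?P (E t) \<noteq> 0"
    and opt: "\<And>E'. norm E' = 1 \<Longrightarrow> ?P E' \<noteq> 0 \<Longrightarrow> F_tilde S A eps t (E t) \<le> F_tilde S A eps t E'"
    if "t > 0" for t
    using E_argmin[OF that] by (auto simp: is_arg_min_def not_less)
  have F: "F_tilde S A eps t E' = - Re (rightmost_eigenvalue (A + eps *\<^sub>R E' + t *\<^sub>R sgn (?P E')))" for t E'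
    by (simp add: F_tilde_def sgn_div_norm divide_inverse)
  have M_sgn: "M t = A + eps *\<^sub>R E t + t *\<^sub>R sgn (?P (E t))" if "t > 0" for t
    using M[OF that] eta[OF that] by (simp add: sgn_div_norm divide_inverse)
  have phi_lam: "phi t = - Re (lam t)" if "t > 0" for t
    using phi[OF that] lam[OF that] M_sgn[OF that] F by simp
  \<comment> \<open>Minimality of \<open>F_tilde\<close> at \<open>E t\<close> means that
    \<open>Re (lam t)\<close> bounds the real parts of all eigenvalues of all admissible
    matrices.\<close>
  have loc: "coupled_maximum S A (E t) (M t) eps t (Re (lam t))" if t: "t \<in> V" for t
  proof
    show "Re m \<le> Re (lam t)" if E': "norm E' = 1" "?P E' \<noteq> 0"
      and m: "eigenvalue (A + eps *\<^sub>R E' + t *\<^sub>R sgn (?P E')) m" for E' m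
      using rightmost_eigenvalue(2)[OF m] opt[OF pos[OF t] E'] phi_lam[OF pos[OF t]] phi[OF pos[OF t]]
      by (simp add: F)
  qed (rule S eps(1) pos[OF t] E[OF pos[OF t]] M_sgn[OF pos[OF t]])+
  have ev: "eigenvalue (M t) (lam t)" if "t \<in> V" for t
    using yV(1)[OF that] by (auto simp: eigenvalue_def)
  have dom: "Re m \<le> Re (lam t)" if "t \<in> V" "eigenvalue (M t) m" for t m
    using rightmost_eigenvalue(2)[OF that(2)] lam[OF pos[OF that(1)]] by simp
  have outer_E: "outer (x t) (y t) = E t" if t: "t \<in> V" for t
    by (rule coupled_maximum.outer_eq[OF loc[OF t] xV[OF t] yV[OF t] refl xyV[OF t]])
  from U(3) obtain E' where E': "\<And>t. t \<in> U \<Longrightarrow> (E has_vector_derivative E' t) (at t)"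
    unfolding C1_differentiable_on_def by blast
  \<comment> \<open>The derivative is written in terms of \<open>E\<close> alone, because
    \<open>x\<close> and \<open>y\<close> are chosen pointwise and may be discontinuous. The trace
    enters since \<open>Re (trace (E t))\<close> is \<open>1 / kappa t\<close> on
    \<open>V\<close>.\<close>
  define D where "D t = - norm (?P (E t)) / Re (trace (E t))" for t
  have trace_E: "Re (trace (E t)) = Re (cdot (x t) (y t))" if t: "t \<in> V" for t
  proof -
    have "trace (E t) = cnj (cdot (x t) (y t))"
      unfolding outer_E[OF t, symmetric] trace_outer cnj_cdot ..
    then show ?thesis by simp
  qed
  have D_eq: "D t = - kappa t * norm (?P (outer (x t) (y t)))" if t: "t \<in> V" for t
    by (simp add: D_def kappaV[OF t] outer_E[OF t] trace_E[OF t])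
  have linP: "bounded_linear ?P"
    using linear_orth_proj[OF S] by (simp add: linear_conv_bounded_linear)

  \<comment> \<open>The derivative of the optimal value\<close>
  have deriv: "(phi has_real_derivative D t) (at t)" if t: "t \<in> V" for t
  proof -
    interpret coupled_maximum S A "E t" "M t" eps t "Re (lam t)" using loc[OF t] .
    have tU: "t \<in> U" using VP[OF t] by blast
    have PE: "((\<lambda>t. ?P (E t)) has_vector_derivative ?P (E' t)) (at t)"
      by (rule bounded_linear.has_vector_derivative[OF linP E'[OF tU]])
    obtain N' where N': "((\<lambda>t. sgn (?P (E t))) has_vector_derivative N') (at t)"
      by (rule sgn_curve_derivative[OF PE proj_E0])
    have "((\<lambda>t. A + eps *\<^sub>R E t + t *\<^sub>R sgn (?P (E t))) has_vector_derivative
        0 + eps *\<^sub>R E' t + (t *\<^sub>R N' + 1 *\<^sub>R sgn (?P (E t)))) (at t)"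
      by (intro has_vector_derivative_add has_vector_derivative_const
          bounded_linear.has_vector_derivative[OF bounded_linear_scaleR_right] E'[OF tU]
          has_vector_derivative_scaleR N' DERIV_ident)
    then have "(M has_vector_derivative 0 + eps *\<^sub>R E' t + (t *\<^sub>R N' + 1 *\<^sub>R sgn (?P (E t)))) (at t)"
      by (rule has_vector_derivative_transform_within_open[OF _ V(1) t]) (simp add: M_sgn pos)
    then have M': "(M has_vector_derivative eps *\<^sub>R E' t + t *\<^sub>R N' + sgn (?P (E t))) (at t)"
      by (simp add: add.assoc)
    have ne: "cdot (x t) (y t) \<noteq> 0" using xyV(2)[OF t] by auto
    have lam': "(lam has_vector_derivative
        cdot (x t) ((eps *\<^sub>R E' t + t *\<^sub>R N' + sgn (?P (E t))) *v y t) / cdot (x t) (y t)) (at t)"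
    proof (rule dominant_eigenvalue_has_vector_derivative[OF V(1) t M' ev dom _ _ _ ne])
      show "m = lam t" if m: "eigenvalue (M t) m" "Re m = Re (lam t)" for m
        using left_eigenvector_unique(2)[OF xV(1)[OF t] refl _ m(2)] m(1)
          eigenvalue_iff_left_eigenvector by blast
      show "\<exists>c. z = c *s x t" if "left_eigenvector (M t) (lam t) z" for z
        by (rule left_eigenvector_unique(1)[OF xV(1)[OF t] refl that refl])
      show "M t *v y t = lam t *s y t" using yV(1)[OF t] by (simp add: right_eigenvector_def)
    qed
    have EE': "inner (E t) (E' t) = 0"
      by (rule unit_curve_inner_derivative[OF V(1) t E'[OF tU]]) (simp add: E pos)
    have NN': "inner (sgn (?P (E t))) N' = 0"
      by (rule unit_curve_inner_derivative[OF V(1) t N']) (simp add: E pos norm_sgn)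
    \<comment> \<open>The curve of normalized projections is fixed by the linear map
      \<open>?P\<close>, hence so is its derivative.\<close>
    have "?P N' = N'"
    proof (rule vector_derivative_unique_at)
      show "((\<lambda>t. sgn (?P (E t))) has_vector_derivative ?P N') (at t)"
        using bounded_linear.has_vector_derivative[OF linP N']
        by (simp add: orth_proj_of_mem S sgn_orth_proj_in)
    qed (rule N')
    then have "N' \<in> S" using orth_proj_in[OF S, of N'] by simp
    then have "inner (E t) N' = inner (?P (E t)) N'" by (rule inner_orth_proj[OF S, symmetric])
    then have EN': "inner (E t) N' = 0" using NN' proj_E0 by (simp add: sgn_div_norm)
    \<comment> \<open>Only the summand \<open>sgn (?P (E t))\<close>, which stems from the explicit
      factor \<open>t\<close>, survives the pairing with \<open>E t\<close>.\<close>
    have Re_num: "Re (cdot (x t) ((eps *\<^sub>R E' t + t *\<^sub>R N' + sgn (?P (E t))) *v y t)) = norm (?P (E t))"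
      unfolding inner_outer[symmetric] outer_E[OF t]
      by (simp add: inner_add_right EE' EN' inner_sgn_orth_proj S)
    have "cdot (x t) (y t) = of_real (Re (cdot (x t) (y t)))" using xyV(1)[OF t] by simp
    then have "Re (cdot (x t) ((eps *\<^sub>R E' t + t *\<^sub>R N' + sgn (?P (E t))) *v y t) / cdot (x t) (y t))
        = norm (?P (E t)) / Re (cdot (x t) (y t))"
      unfolding Re_num[symmetric] by (metis Re_divide_of_real)
    also have "\<dots> = - D t"
      by (simp add: D_eq[OF t] kappaV[OF t] outer_E[OF t])
    finally have Re_quot: "Re (cdot (x t) ((eps *\<^sub>R E' t + t *\<^sub>R N' + sgn (?P (E t))) *v y t) / cdot (x t) (y t)) = - D t" .
    have "((\<lambda>t. - Re (lam t)) has_vector_derivative - (- D t)) (at t)"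
      unfolding Re_quot[symmetric]
      by (intro has_vector_derivative_minus bounded_linear.has_vector_derivative[OF bounded_linear_Re lam'])
    then have "((\<lambda>t. - Re (lam t)) has_vector_derivative D t) (at t)" by simp
    then have "(phi has_vector_derivative D t) (at t)"
      by (rule has_vector_derivative_transform_within_open[OF _ V(1) t]) (simp add: phi_lam pos)
    then show ?thesis by (simp add: has_real_derivative_iff_has_vector_derivative)
  qed

  \<comment> \<open>Continuity of the derivative\<close>
  have "continuous_on V D"
  proof -
    have cE: "continuous_on V E"
    proof (rule continuous_at_imp_continuous_on, rule ballI)
      fix t assume "t \<in> V"
      then have "t \<in> U" using VP by blast
      then show "isCont E t" by (intro has_vector_derivative_continuous[OF E'])
    qed
    have nz: "Re (trace (E t)) \<noteq> 0" if "t \<in> V" for t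
      using xyV(2)[OF that] trace_E[OF that] by simp
    have tr: "continuous_on V (\<lambda>t. Re (trace (E t)))"
      unfolding trace_def by (intro continuous_intros cE)
    show ?thesis
      unfolding D_def
      by (intro continuous_on_divide continuous_on_minus continuous_on_norm tr
          bounded_linear.continuous_on[OF linP] cE ballI nz)
  qed
  moreover have "\<forall>t\<in>V. (phi has_vector_derivative D t) (at t)"
    using deriv by (simp add: has_real_derivative_iff_has_vector_derivative)
  ultimately have "phi C1_differentiable_on V"
    unfolding C1_differentiable_on_def by blast
  moreover have "(phi has_real_derivative - kappa t * norm (?P (outer (x t) (y t)))) (at t)"
    if "t \<in> V" for t
    using deriv[OF that] unfolding D_eq[OF that] .
  ultimately show ?thesis
    using V phi_lam pos by (intro exI[of _ V]) simp
qed

end
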